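(* There is a constant $c>0$ and a family of critical graphs containing no triangles and no pentagons (i.e. no odd cycles of length $3$ or $5$), whose members have unbounded chromatic number and each member on $n$ vertices has more than $cn^2$ edges. In particular, the density constants satisfy $c_{5,4}\geq \frac{1}{36}$, $c_{5,5}\geq \frac{3}{35}$, and $c_{5,k}=\frac14$ for all $k\geq 6$.
   Context: A graph is $k$-critical if it has chromatic number $k$ and removing any edge allows it to be properly $(k-1)$-colored; a graph is critical if it is $k$-critical for some $k$. The odd-girth of a graph is the length of a shortest odd cycle. For integers $\ell\geq 3$, $k\geq 4$, the density constant $c_{\ell,k}$ is the supremum of the constants $c$ such that there are infinitely many $k$-critical graphs of odd-girth $>\ell$, each having more than $cn^2$ edges, where $n$ is its number of vertices. *)

theory Defs
  imports Complex_Main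
begin

type_synonym 'a graph = "'a set \<times> 'a set set"

definition simple_graph :: "'a graph \<Rightarrow> bool" where
  "simple_graph G \<longleftrightarrow> finite (fst G) \<and>
     (\<forall>e\<in>snd G. \<exists>u v. u \<noteq> v \<and> u \<in> fst G \<and> v \<in> fst G \<and> e = {u, v})"

definition colorable :: "'a graph \<Rightarrow> nat \<Rightarrow> bool" where
  "colorable G k \<longleftrightarrow> (\<exists>f :: 'a \<Rightarrow> nat. f ` fst G \<subseteq> {..<k} \<and>
     (\<forall>u v. {u, v} \<in> snd G \<longrightarrow> u \<noteq> v \<longrightarrow> f u \<noteq> f v))"

definition chromatic_number :: "'a graph \<Rightarrow> nat" where
  "chromatic_number G = (LEAST k. colorable G k)"

definition k_critical :: "'a graph \<Rightarrow> nat \<Rightarrow> bool" where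
  "k_critical G k \<longleftrightarrow> chromatic_number G = k \<and>
     (\<forall>e\<in>snd G. colorable (fst G, snd G - {e}) (k - 1))"

definition critical :: "'a graph \<Rightarrow> bool" where
  "critical G \<longleftrightarrow> (\<exists>k. k_critical G k)"

definition is_cycle :: "'a graph \<Rightarrow> 'a list \<Rightarrow> bool" where
  "is_cycle G xs \<longleftrightarrow> length xs \<ge> 3 \<and> distinct xs \<and> set xs \<subseteq> fst G \<and>
     (\<forall>i < length xs. {xs ! i, xs ! ((i + 1) mod length xs)} \<in> snd G)"

definition odd_girth_gt :: "'a graph \<Rightarrow> nat \<Rightarrow> bool" where
  "odd_girth_gt G l \<longleftrightarrow> (\<forall>xs. is_cycle G xs \<and> odd (length xs) \<longrightarrow> length xs > l)"

definition graph_iso :: "'a graph \<Rightarrow> 'b graph \<Rightarrow> bool" where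
  "graph_iso G H \<longleftrightarrow> (\<exists>f. bij_betw f (fst G) (fst H) \<and>
     (\<forall>u\<in>fst G. \<forall>v\<in>fst G. {u, v} \<in> snd G \<longleftrightarrow> {f u, f v} \<in> snd H))"

text \<open>Infinitely many graphs (up to isomorphism) with property P, on vertex set nat
  (every finite graph is isomorphic to one on nat).\<close>
definition infinitely_many_graphs :: "(nat graph \<Rightarrow> bool) \<Rightarrow> bool" where
  "infinitely_many_graphs P \<longleftrightarrow>
     \<not> (\<exists>F :: nat graph set. finite F \<and> (\<forall>G. P G \<longrightarrow> (\<exists>H\<in>F. graph_iso G H)))"

definition density_const :: "nat \<Rightarrow> nat \<Rightarrow> real" where
  "density_const l k = Sup {c :: real. infinitely_many_graphs (\<lambda>G.
     simple_graph G \<and> k_critical G k \<and> odd_girth_gt G l \<and>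
     real (card (snd G)) > c * (real (card (fst G)))\<^sup>2)}"

end

theory Submission
  imports Defs "HOL-Library.Countable"
begin

text \<open>Take a graph that is not \<open>c\<close>-colourable and contains a complete bipartite graph between two sets
  \<open>X\<close> and \<open>Y\<close> all of whose edges are critical: every \<open>(c + 1)\<close>-critical subgraph keeps these edges, so
  it is dense as soon as \<open>X\<close> and \<open>Y\<close> contain a constant proportion of the vertices. Short odd cycles
  can be avoided because all edges but linearly many (in \<open>N\<close>, where there are about \<open>N\<^sup>2\<close> vertices) form a
  bipartite graph, and the remaining ones can be replaced by large gadgets of constant size
  (a Hajos-type construction, applied to a critical subgraph of a shift graph of odd girth \<open>7\<close>).

  The set \<open>X\<close> is built so that it always contains the colour \<open>0\<close>, possibly at a single prescribed vertex
  only, with the other colours of \<open>X\<close> in a set \<open>P\<close>; likewise for \<open>Y\<close> with a set \<open>Q\<close> disjoint from \<open>P\<close>.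
  If \<open>X\<close> consists of vertices \<open>x\<^sub>i\<^sub>j\<close> joined to \<open>u\<^sub>i\<close> and \<open>v\<^sub>j\<close>, where the \<open>u\<^sub>i\<close> use the colours \<open>0, p\<close> and
  the \<open>v\<^sub>j\<close> the colours \<open>0, q\<close>, neither of them only \<open>0\<close>, then \<open>P = {p, q}\<close> and almost all vertices of the
  side lie in \<open>X\<close>. If only one colour is available for \<open>P\<close>, then \<open>X\<close> is matched to such a layer, which
  halves the proportion. For \<open>c \<ge> 5\<close>, \<open>c = 4\<close>, \<open>c = 3\<close> this gives the densities \<open>1/4\<close>, \<open>1/9\<close> and \<open>1/16\<close>.\<close>

section \<open>Critical subgraphs and odd cycles\<close>

lemma colorable_mono: "colorable G k \<Longrightarrow> k \<le> k' \<Longrightarrow> colorable G k'"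
  unfolding colorable_def by (meson lessThan_subset_iff subset_trans)

lemma colorable_subset: "colorable (V, E) k \<Longrightarrow> E' \<subseteq> E \<Longrightarrow> colorable (V, E') k"
  unfolding colorable_def by auto blast

lemma simple_graph_subset: "simple_graph (V, E) \<Longrightarrow> E' \<subseteq> E \<Longrightarrow> simple_graph (V, E')"
  unfolding simple_graph_def by auto

lemma simple_graph_edge:
  assumes "simple_graph (V, E)" and "{x, y} \<in> E"
  shows "x \<noteq> y" and "x \<in> V" and "y \<in> V"
proof -
  obtain u v where "u \<noteq> v" "u \<in> V" "v \<in> V" "{x, y} = {u, v}"
    using assms unfolding simple_graph_def by (metis fst_conv snd_conv)
  then show "x \<noteq> y" "x \<in> V" "y \<in> V" by (auto simp: doubleton_eq_iff)
qed

lemma simple_graph_edgeE: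
  assumes "simple_graph (V, E)" and "e \<in> E"
  obtains u v where "u \<noteq> v" and "u \<in> V" and "v \<in> V" and "e = {u, v}"
  using assms unfolding simple_graph_def by (metis snd_conv fst_conv)

lemma simple_graph_finite_edges:
  assumes "simple_graph (V, E)"
  shows "finite E"
proof (rule finite_subset)
  show "E \<subseteq> Pow V" using assms unfolding simple_graph_def by auto
  show "finite (Pow V)" using assms unfolding simple_graph_def by auto
qed

text \<open>Finiteness yields an inclusion-minimal edge set without a \<open>c\<close>-colouring.
  Only edges are discarded, so the number of vertices, which enters the density, stays
  fixed.\<close>

lemma critical_edge_set:
  assumes "simple_graph (V, E)" and "\<not> colorable (V, E) c"
  obtains E' where "E' \<subseteq> E" and "\<not> colorable (V, E') c"
    and "\<And>e. e \<in> E' \<Longrightarrow> colorable (V, E' - {e}) c"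
proof -
  let ?S = "{E'. E' \<subseteq> E \<and> \<not> colorable (V, E') c}"
  have "finite ?S" using simple_graph_finite_edges[OF assms(1)] by simp
  moreover have "?S \<noteq> {}" using assms(2) by auto
  ultimately obtain E' where E': "E' \<in> ?S" "\<forall>F\<in>?S. F \<subseteq> E' \<longrightarrow> E' = F"
    using finite_has_minimal[of ?S] by blast
  have "colorable (V, E' - {e}) c" if "e \<in> E'" for e
    using E' that by blast
  then show ?thesis using that E'(1) by auto
qed

text \<open>Giving one end of a deleted edge the new colour \<open>c\<close> turns a
  \<open>c\<close>-colouring of the rest into a \<open>Suc c\<close>-colouring, so the chromatic
  number is exactly \<open>Suc c\<close>. The bound \<open>c \<ge> 1\<close> guarantees that there
  is an edge to delete.\<close>

lemma k_critical_if_edge_deletions_colorable: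
  assumes simple: "simple_graph (V, E)" and nc: "\<not> colorable (V, E) c" and "c \<ge> 1"
    and del: "\<And>e. e \<in> E \<Longrightarrow> colorable (V, E - {e}) c"
  shows "k_critical (V, E) (Suc c)"
proof -
  have "E \<noteq> {}"
  proof
    assume "E = {}"
    then have "colorable (V, E) c" unfolding colorable_def using \<open>c \<ge> 1\<close>
      by (intro exI[of _ "\<lambda>_. 0"]) auto
    then show False using nc by simp
  qed
  then obtain e where e: "e \<in> E" by auto
  then obtain u v where uv: "u \<noteq> v" "u \<in> V" "v \<in> V" "e = {u, v}"
    using simple unfolding simple_graph_def by auto
  obtain f where f: "f ` V \<subseteq> {..<c}" "\<And>x y. {x, y} \<in> E - {e} \<Longrightarrow> x \<noteq> y \<Longrightarrow> f x \<noteq> f y"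
    using del[OF e] unfolding colorable_def by auto
  have "colorable (V, E) (Suc c)" unfolding colorable_def
  proof (intro exI[of _ "f(u := c)"] conjI allI impI)
    show "(f(u := c)) ` fst (V, E) \<subseteq> {..<Suc c}" using f(1) by (auto simp: less_Suc_eq)
    fix x y assume xy: "{x, y} \<in> snd (V, E)" "x \<noteq> y"
    then have "x \<in> V" "y \<in> V" using simple_graph_edge[OF simple] by auto
    then have "f x < c" "f y < c" using f(1) by auto
    then show "(f(u := c)) x \<noteq> (f(u := c)) y"
      using xy f(2)[of x y] uv by (auto simp: doubleton_eq_iff)
  qed
  moreover have "Suc c \<le> k" if "colorable (V, E) k" for k
    using colorable_mono[OF that, of c] nc by (meson not_less_eq_eq)
  ultimately have "chromatic_number (V, E) = Suc c"
    unfolding chromatic_number_def by (rule Least_equality)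
  then show ?thesis using del unfolding k_critical_def by auto
qed

section \<open>Renaming vertices along an injection\<close>

lemma edge_image_iff:
  assumes "inj h"
  shows "{h x, h y} \<in> (`) h ` E \<longleftrightarrow> {x, y} \<in> E"
proof -
  have "{h x, h y} = h ` {x, y}" by simp
  then show ?thesis using assms by (metis (no_types, lifting) image_iff inj_image_eq_iff)
qed

lemma edge_image_endpoints:
  assumes "{u, v} \<in> (`) h ` E"
  obtains x y where "u = h x" and "v = h y"
  using assms by blast

lemma colorable_image_iff:
  assumes "inj h"
  shows "colorable (h ` V, (`) h ` E) k \<longleftrightarrow> colorable (V, E) k"
proof
  assume "colorable (h ` V, (`) h ` E) k"
  then obtain f where f: "f ` h ` V \<subseteq> {..<k}"
    "\<And>u v. {u, v} \<in> (`) h ` E \<Longrightarrow> u \<noteq> v \<Longrightarrow> f u \<noteq> f v"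
    unfolding colorable_def by auto
  show "colorable (V, E) k" unfolding colorable_def
  proof (intro exI[of _ "f \<circ> h"] conjI allI impI)
    show "(f \<circ> h) ` fst (V, E) \<subseteq> {..<k}" using f(1) by auto
    fix u v assume "{u, v} \<in> snd (V, E)" "u \<noteq> v"
    then show "(f \<circ> h) u \<noteq> (f \<circ> h) v"
      using f(2)[of "h u" "h v"] assms by (simp add: edge_image_iff inj_eq)
  qed
next
  assume "colorable (V, E) k"
  then obtain f where f: "f ` V \<subseteq> {..<k}" "\<And>u v. {u, v} \<in> E \<Longrightarrow> u \<noteq> v \<Longrightarrow> f u \<noteq> f v"
    unfolding colorable_def by auto
  show "colorable (h ` V, (`) h ` E) k" unfolding colorable_def
  proof (intro exI[of _ "f \<circ> inv h"] conjI allI impI)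
    show "(f \<circ> inv h) ` fst (h ` V, (`) h ` E) \<subseteq> {..<k}" using f(1) assms by auto
    fix u v assume uv: "{u, v} \<in> snd (h ` V, (`) h ` E)" "u \<noteq> v"
    then obtain x y where xy: "u = h x" "v = h y" by (metis edge_image_endpoints snd_conv)
    then have "{x, y} \<in> E" "x \<noteq> y" using uv edge_image_iff[OF assms] by auto
    then show "(f \<circ> inv h) u \<noteq> (f \<circ> inv h) v" using f(2)[of x y] xy assms by simp
  qed
qed

text \<open>Vertices may repeat, so closed walks are excluded rather than cycles. In a simple graph
  this amounts to odd girth above 5, and no distinctness has to be carried through case
  distinctions.\<close>

definition triangle_pentagon_free :: "'a set set \<Rightarrow> bool" where
  "triangle_pentagon_free E \<longleftrightarrow>
     (\<forall>u v w. \<not> ({u, v} \<in> E \<and> {v, w} \<in> E \<and> {w, u} \<in> E)) \<and>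
     (\<forall>u v w x y. \<not> ({u, v} \<in> E \<and> {v, w} \<in> E \<and> {w, x} \<in> E \<and> {x, y} \<in> E \<and> {y, u} \<in> E))"

lemma triangle_pentagon_freeD:
  assumes "triangle_pentagon_free E"
  shows "{u, v} \<in> E \<Longrightarrow> {v, w} \<in> E \<Longrightarrow> {w, u} \<in> E \<Longrightarrow> False"
    and "{u, v} \<in> E \<Longrightarrow> {v, w} \<in> E \<Longrightarrow> {w, x} \<in> E \<Longrightarrow> {x, y} \<in> E \<Longrightarrow> {y, u} \<in> E \<Longrightarrow> False"
  using assms[unfolded triangle_pentagon_free_def, THEN conjunct1, rule_format, of u v w]
    assms[unfolded triangle_pentagon_free_def, THEN conjunct2, rule_format, of u v w x y]
  by simp_all

lemma odd_girth_gt_5I: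
  assumes "triangle_pentagon_free E"
  shows "odd_girth_gt (V, E) 5"
  unfolding odd_girth_gt_def
proof (intro allI impI, rule ccontr)
  fix xs assume xs: "is_cycle (V, E) xs \<and> odd (length xs)" and "\<not> 5 < length xs"
  then have len: "length xs \<ge> 3" "length xs \<le> 5" "odd (length xs)"
    and adj: "\<And>i. i < length xs \<Longrightarrow> {xs ! i, xs ! ((i + 1) mod length xs)} \<in> E"
    unfolding is_cycle_def by auto
  have "length xs \<noteq> 4" using len(3) by auto
  then consider "length xs = 3" | "length xs = 5" using len by linarith
  then show False
  proof cases
    case 1
    have "{xs ! 0, xs ! 1} \<in> E" using adj[of 0] 1 by simp
    moreover have "{xs ! 1, xs ! 2} \<in> E" using adj[of 1] 1 by (simp add: numeral_2_eq_2)
    moreover have "{xs ! 2, xs ! 0} \<in> E" using adj[of 2] 1 by simp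
    ultimately show False by (rule triangle_pentagon_freeD(1)[OF assms])
  next
    case 2
    have "{xs ! 0, xs ! 1} \<in> E" using adj[of 0] 2 by simp
    moreover have "{xs ! 1, xs ! 2} \<in> E" using adj[of 1] 2 by (simp add: numeral_2_eq_2)
    moreover have "{xs ! 2, xs ! 3} \<in> E" using adj[of 2] 2 by simp
    moreover have "{xs ! 3, xs ! 4} \<in> E" using adj[of 3] 2 by simp
    moreover have "{xs ! 4, xs ! 0} \<in> E" using adj[of 4] 2 by simp
    ultimately show False by (rule triangle_pentagon_freeD(2)[OF assms])
  qed
qed

lemma triangle_pentagon_freeI:
  assumes "\<And>u v w. {u, v} \<in> E \<Longrightarrow> {v, w} \<in> E \<Longrightarrow> {w, u} \<in> E \<Longrightarrow> False"
    and "\<And>u v w x y. {u, v} \<in> E \<Longrightarrow> {v, w} \<in> E \<Longrightarrow> {w, x} \<in> E \<Longrightarrow> {x, y} \<in> E \<Longrightarrow> {y, u} \<in> E \<Longrightarrow> False"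
  shows "triangle_pentagon_free E"
  unfolding triangle_pentagon_free_def
proof (intro conjI allI notI)
  fix u v w assume "{u, v} \<in> E \<and> {v, w} \<in> E \<and> {w, u} \<in> E"
  then show False by (elim conjE) (rule assms(1))
next
  fix u v w x y
  assume "{u, v} \<in> E \<and> {v, w} \<in> E \<and> {w, x} \<in> E \<and> {x, y} \<in> E \<and> {y, u} \<in> E"
  then show False by (elim conjE) (rule assms(2))
qed

lemma triangle_pentagon_free_image:
  assumes inj: "inj h" and free: "triangle_pentagon_free E"
  shows "triangle_pentagon_free ((`) h ` E)"
proof (rule triangle_pentagon_freeI)
  fix u v w
  assume A: "{u, v} \<in> (`) h ` E" "{v, w} \<in> (`) h ` E" "{w, u} \<in> (`) h ` E"
  from A(1) obtain u' v' where uv: "u = h u'" "v = h v'" by (rule edge_image_endpoints)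
  from A(3) obtain w' where w: "w = h w'" by (rule edge_image_endpoints)
  from A show False
    unfolding uv w edge_image_iff[OF inj] by (rule triangle_pentagon_freeD(1)[OF free])
next
  fix u v w x y
  assume A: "{u, v} \<in> (`) h ` E" "{v, w} \<in> (`) h ` E" "{w, x} \<in> (`) h ` E"
    "{x, y} \<in> (`) h ` E" "{y, u} \<in> (`) h ` E"
  from A(1) obtain u' v' where uv: "u = h u'" "v = h v'" by (rule edge_image_endpoints)
  from A(3) obtain w' x' where wx: "w = h w'" "x = h x'" by (rule edge_image_endpoints)
  from A(5) obtain y' where y: "y = h y'" by (rule edge_image_endpoints)
  from A show False
    unfolding uv wx y edge_image_iff[OF inj] by (rule triangle_pentagon_freeD(2)[OF free])
qed

lemma triangle_pentagon_free_subset: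
  "triangle_pentagon_free E \<Longrightarrow> E' \<subseteq> E \<Longrightarrow> triangle_pentagon_free E'"
proof (rule triangle_pentagon_freeI)
  assume free: "triangle_pentagon_free E" and sub: "E' \<subseteq> E"
  show False if "{u, v} \<in> E'" "{v, w} \<in> E'" "{w, u} \<in> E'" for u v w
    using that[THEN subsetD[OF sub]] by (rule triangle_pentagon_freeD(1)[OF free])
  show False if "{u, v} \<in> E'" "{v, w} \<in> E'" "{w, x} \<in> E'" "{x, y} \<in> E'" "{y, u} \<in> E'" for u v w x y
    using that[THEN subsetD[OF sub]] by (rule triangle_pentagon_freeD(2)[OF free])
qed

text \<open>An edge whose deletion makes the graph colourable survives in every critical subgraph.\<close>

lemma critical_nat_graph:
  fixes V :: "'a :: countable set"
  assumes simple: "simple_graph (V, E)" and nc: "\<not> colorable (V, E) c" and c: "c \<ge> 1"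
    and free: "triangle_pentagon_free E"
    and E0: "E0 \<subseteq> E" and del: "\<And>e. e \<in> E0 \<Longrightarrow> colorable (V, E - {e}) c"
  obtains G :: "nat graph" where "simple_graph G" and "k_critical G (Suc c)"
    and "odd_girth_gt G 5" and "card (fst G) = card V" and "card (snd G) \<ge> card E0"
proof -
  obtain E' where E': "E' \<subseteq> E" "\<not> colorable (V, E') c"
    "\<And>e. e \<in> E' \<Longrightarrow> colorable (V, E' - {e}) c"
    using critical_edge_set[OF simple nc] by blast
  have "E0 \<subseteq> E'"
  proof
    fix e assume e: "e \<in> E0"
    show "e \<in> E'"
    proof (rule ccontr)
      assume "e \<notin> E'"
      then have "E' \<subseteq> E - {e}" using E'(1) by auto
      then show False using colorable_subset[OF del[OF e]] E'(2) by blast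
    qed
  qed
  have simple': "simple_graph (V, E')" using simple_graph_subset[OF simple E'(1)] .
  then have fin: "finite E'" by (rule simple_graph_finite_edges)
  let ?h = "to_nat :: 'a \<Rightarrow> nat"
  have inj: "inj ?h" by simp
  then have injE: "inj ((`) ?h)" by (simp add: inj_image_eq_iff inj_def)
  let ?G = "(?h ` V, (`) ?h ` E')"
  have simG: "simple_graph ?G" unfolding simple_graph_def
  proof (intro conjI ballI)
    show "finite (fst ?G)" using simple' unfolding simple_graph_def by simp
    fix e assume "e \<in> snd ?G"
    then obtain e' where e': "e' \<in> E'" "e = ?h ` e'" by auto
    then obtain u v where "u \<noteq> v" "u \<in> V" "v \<in> V" "e' = {u, v}"
      using simple' unfolding simple_graph_def by auto
    then show "\<exists>u v. u \<noteq> v \<and> u \<in> fst ?G \<and> v \<in> fst ?G \<and> e = {u, v}"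
      using e' by (intro exI[of _ "?h u"] exI[of _ "?h v"]) simp
  qed
  have "k_critical ?G (Suc c)"
  proof (rule k_critical_if_edge_deletions_colorable[OF simG _ c])
    show "\<not> colorable ?G c" using E'(2) by (simp only: colorable_image_iff[OF inj] not_False_eq_True)
    fix e assume "e \<in> (`) ?h ` E'"
    then obtain e' where e': "e' \<in> E'" "e = ?h ` e'" by auto
    have "(`) ?h ` E' - {e} = (`) ?h ` (E' - {e'})"
      using injE e' by (simp add: image_set_diff)
    then show "colorable (?h ` V, (`) ?h ` E' - {e}) c"
      using E'(3)[OF e'(1)] by (simp only: colorable_image_iff[OF inj])
  qed
  moreover have "odd_girth_gt ?G 5"
    using odd_girth_gt_5I triangle_pentagon_free_image[OF inj]
      triangle_pentagon_free_subset[OF free E'(1)] by blast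
  moreover have "card (fst ?G) = card V" by (simp add: card_image inj_on_def)
  moreover have "card (snd ?G) = card E'" using injE by (simp add: card_image inj_on_subset)
  moreover have "card E0 \<le> card E'" using \<open>E0 \<subseteq> E'\<close> fin by (rule card_mono[rotated])
  ultimately show ?thesis using that[of ?G] simG by simp
qed

section \<open>Inequality gadgets from shift graphs\<close>

definition shift_vertices :: "nat \<Rightarrow> (nat \<times> nat \<times> nat) set" where
  "shift_vertices n = {(i, j, k) | i j k. i < j \<and> j < k \<and> k < n}"

definition shift_edges :: "nat \<Rightarrow> (nat \<times> nat \<times> nat) set set" where
  "shift_edges n = {{(i, j, k), (j, k, l)} | i j k l. i < j \<and> j < k \<and> k < l \<and> l < n}"

lemma simple_graph_shift: "simple_graph (shift_vertices n, shift_edges n)"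
  unfolding simple_graph_def
proof (intro conjI ballI)
  have "shift_vertices n \<subseteq> {..<n} \<times> {..<n} \<times> {..<n}"
    unfolding shift_vertices_def by auto
  then show "finite (fst (shift_vertices n, shift_edges n))"
    by (auto intro: finite_subset)
  fix e assume "e \<in> snd (shift_vertices n, shift_edges n)"
  then obtain i j k l where e: "i < j" "j < k" "k < l" "l < n" "e = {(i, j, k), (j, k, l)}"
    unfolding shift_edges_def by auto
  then have "(i, j, k) \<in> shift_vertices n" "(j, k, l) \<in> shift_vertices n"
    unfolding shift_vertices_def by simp_all
  moreover have "(i, j, k) \<noteq> (j, k, l)" using e by simp
  ultimately show "\<exists>u v. u \<noteq> v \<and> u \<in> fst (shift_vertices n, shift_edges n)
      \<and> v \<in> fst (shift_vertices n, shift_edges n) \<and> e = {u, v}"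
    using e(5) by (metis fst_conv)
qed

lemma shift_edge_cases:
  assumes "{(i, j, k), (i', j', k')} \<in> shift_edges n"
  shows "i < j" and "j < k" and "i' < j'" and "j' < k'"
    and "j = i' \<and> k = j' \<or> j' = i \<and> k' = j"
  using assms unfolding shift_edges_def by (auto simp: doubleton_eq_iff)

text \<open>Each edge shifts a triple one step forwards or backwards along an increasing sequence.
  Every pattern of directions around a closed walk of length 3 or 5 identifies entries that are
  strictly ordered.\<close>

lemma triangle_pentagon_free_shift: "triangle_pentagon_free (shift_edges n)"
proof (rule triangle_pentagon_freeI)
  fix u v w
  assume A: "{u, v} \<in> shift_edges n" "{v, w} \<in> shift_edges n" "{w, u} \<in> shift_edges n"
  obtain u1 u2 u3 v1 v2 v3 w1 w2 w3
    where "u = (u1, u2, u3)" "v = (v1, v2, v3)" "w = (w1, w2, w3)"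
    by (metis prod_cases3)
  note A = A[unfolded this]
  show False
    using shift_edge_cases[OF A(1)] shift_edge_cases[OF A(2)] shift_edge_cases[OF A(3)]
    by (elim disjE conjE; hypsubst_thin+; linarith)
next
  fix u v w x y
  assume A: "{u, v} \<in> shift_edges n" "{v, w} \<in> shift_edges n" "{w, x} \<in> shift_edges n"
    "{x, y} \<in> shift_edges n" "{y, u} \<in> shift_edges n"
  obtain u1 u2 u3 v1 v2 v3 w1 w2 w3 x1 x2 x3 y1 y2 y3
    where "u = (u1, u2, u3)" "v = (v1, v2, v3)" "w = (w1, w2, w3)" "x = (x1, x2, x3)"
      "y = (y1, y2, y3)"
    by (metis prod_cases3)
  note A = A[unfolded this]
  show False
    using shift_edge_cases[OF A(1)] shift_edge_cases[OF A(2)] shift_edge_cases[OF A(3)]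
      shift_edge_cases[OF A(4)] shift_edge_cases[OF A(5)]
    by (elim disjE conjE; hypsubst_thin+; linarith)
qed

text \<open>Twice passing to the set of colours seen further to the right turns a \<open>c\<close>-colouring into
  an injection from \<open>{..<n}\<close> to a set with \<open>2 ^ 2 ^ c\<close> elements.\<close>

lemma shift_not_colorable:
  assumes "n > 2 ^ 2 ^ c"
  shows "\<not> colorable (shift_vertices n, shift_edges n) c"
proof
  assume "colorable (shift_vertices n, shift_edges n) c"
  then obtain f where f: "f ` shift_vertices n \<subseteq> {..<c}"
    "\<And>u v. {u, v} \<in> shift_edges n \<Longrightarrow> u \<noteq> v \<Longrightarrow> f u \<noteq> f v"
    unfolding colorable_def by auto
  define S where "S i j = {f (i, j, k) | k. j < k \<and> k < n}" for i j
  define T where "T i = {S i j | j. i < j \<and> j < n}" for i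
  have neq: "T i \<noteq> T j" if "i < j" "j < n" for i j
  proof
    assume "T i = T j"
    \<comment> \<open>\<open>S i j\<close> then equals some \<open>S j k\<close>, so the colour of
      \<open>(i, j, k)\<close>, which lies in \<open>S i j\<close>, recurs on a neighbour
      \<open>(j, k, l)\<close>.\<close>
    then have "S i j \<in> T j" using that unfolding T_def by blast
    then obtain k where k: "j < k" "k < n" "S i j = S j k" unfolding T_def by blast
    then have "f (i, j, k) \<in> S j k" unfolding S_def by blast
    then obtain l where l: "k < l" "l < n" "f (i, j, k) = f (j, k, l)" unfolding S_def by blast
    have "{(i, j, k), (j, k, l)} \<in> shift_edges n"
      unfolding shift_edges_def using that k l by blast
    then show False using f(2)[of "(i, j, k)" "(j, k, l)"] l(3) that by auto
  qed
  have "inj_on T {..<n}"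
    by (rule inj_onI) (metis lessThan_iff linorder_neqE_nat neq)
  moreover have "T ` {..<n} \<subseteq> Pow (Pow {..<c})"
  proof -
    have "f (i, j, k) < c" if "i < j" "j < k" "k < n" for i j k
      using f(1) that unfolding shift_vertices_def by blast
    then show ?thesis unfolding T_def S_def by auto
  qed
  ultimately have "card {..<n} \<le> card (Pow (Pow {..<c}))"
    by (intro card_inj_on_le) auto
  then show False using assms by (simp add: card_Pow)
qed

section \<open>Equality gadgets from critical edges\<close>

text \<open>Once the critical edge \<open>{a, b}\<close> is deleted, \<open>c\<close>-colourings
  exist, but all of them give \<open>a\<close> and \<open>b\<close> the same colour: otherwise they
  would colour the whole graph.\<close>

locale equality_gadget =
  fixes c :: nat and VG :: "'g set" and EG :: "'g set set" and a b :: 'g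
  assumes simpleG: "simple_graph (VG, EG)"
    and freeG: "triangle_pentagon_free EG"
    and abG: "{a, b} \<in> EG"
    and not_colorableG: "\<not> colorable (VG, EG) c"
    and colorableG: "colorable (VG, EG - {{a, b}}) c"
begin

lemmas edgeG = simple_graph_edge[OF simpleG]

lemma finiteG: "finite VG"
  using simpleG unfolding simple_graph_def by simp

lemma equal_ends:
  assumes "h ` VG \<subseteq> {..<c}" and "\<And>x y. {x, y} \<in> EG \<Longrightarrow> {x, y} \<noteq> {a, b} \<Longrightarrow> h x \<noteq> h y"
  shows "h a = h b"
proof (rule ccontr)
  assume "h a \<noteq> h b"
  then have "h x \<noteq> h y" if "{x, y} \<in> EG" for x y
    using assms(2)[of x y] that by (cases "{x, y} = {a, b}") (auto simp: doubleton_eq_iff)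
  then have "colorable (VG, EG) c"
    unfolding colorable_def using assms(1) by (intro exI[of _ h]) simp
  then show False using not_colorableG by simp
qed

lemma equal_ends_coloring:
  obtains h where "h ` VG \<subseteq> {..<c}" and "h a = h b"
    and "\<And>x y. {x, y} \<in> EG \<Longrightarrow> {x, y} \<noteq> {a, b} \<Longrightarrow> h x \<noteq> h y"
proof -
  obtain h where h: "h ` VG \<subseteq> {..<c}"
    "\<And>x y. {x, y} \<in> EG - {{a, b}} \<Longrightarrow> x \<noteq> y \<Longrightarrow> h x \<noteq> h y"
    using colorableG unfolding colorable_def by auto
  then have "h x \<noteq> h y" if "{x, y} \<in> EG" "{x, y} \<noteq> {a, b}" for x y
    using edgeG(1)[OF that(1)] that by simp
  then show ?thesis using that h(1) equal_ends[of h] by blast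
qed

end

text \<open>Any edge of a minimal non-\<open>c\<close>-colourable subgraph of a large shift graph
  can serve as \<open>{a, b}\<close>.\<close>

lemma equality_gadget_exists:
  assumes "c \<ge> 1"
  shows "\<exists>VG (EG :: (nat \<times> nat \<times> nat) set set) a b. equality_gadget c VG EG a b"
proof -
  define n where "n = Suc (2 ^ 2 ^ c)"
  have "\<not> colorable (shift_vertices n, shift_edges n) c"
    by (rule shift_not_colorable) (simp add: n_def)
  then obtain E' where E': "E' \<subseteq> shift_edges n" "\<not> colorable (shift_vertices n, E') c"
    "\<And>e. e \<in> E' \<Longrightarrow> colorable (shift_vertices n, E' - {e}) c"
    using critical_edge_set[OF simple_graph_shift] by blast
  have simple: "simple_graph (shift_vertices n, E')"
    using simple_graph_subset[OF simple_graph_shift E'(1)] .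
  have "E' \<noteq> {}"
  proof
    assume "E' = {}"
    then have "colorable (shift_vertices n, E') c"
      unfolding colorable_def using \<open>c \<ge> 1\<close> by (intro exI[of _ "\<lambda>_. 0"]) auto
    then show False using E'(2) by simp
  qed
  then obtain e where e: "e \<in> E'" by blast
  then obtain a b where "e = {a, b}" using simple unfolding simple_graph_def by auto
  then have "equality_gadget c (shift_vertices n) E' a b"
    using simple E' e triangle_pentagon_free_subset[OF triangle_pentagon_free_shift E'(1)]
    by unfold_locales auto
  then show ?thesis by blast
qed

section \<open>Replacing pairs of vertices by gadgets\<close>

datatype 'v gadget_vertex = Terminal 'v | Inner "'v \<times> 'v" "nat \<times> nat \<times> nat"

instance gadget_vertex :: (countable) countable
  by countable_datatype

text \<open>Every pair \<open>(p, q) \<in> W\<close> is replaced by the gadget with the edge \<open>{a, b}\<close> deleted, \<open>a\<close>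
  identified with \<open>p\<close> and \<open>b\<close> joined to \<open>q\<close>: this forces the ends to get different colours, but the
  ends are too far apart for a short odd cycle to pass through.\<close>

locale gadget_replacement = equality_gadget c VG EG a b
  for c and VG :: "(nat \<times> nat \<times> nat) set" and EG a b +
  fixes V :: "'v :: countable set" and R W :: "('v \<times> 'v) set" and side :: "'v \<Rightarrow> bool"
  assumes finite_V: "finite V"
    and R_subset: "R \<subseteq> V \<times> V" and W_subset: "W \<subseteq> V \<times> V"
    and bipartite: "(u, v) \<in> R \<Longrightarrow> side u \<noteq> side v"
    and W_irrefl: "(u, v) \<in> W \<Longrightarrow> u \<noteq> v"
    and W_R_disjoint: "(u, v) \<in> W \<Longrightarrow> (u, v) \<notin> R \<and> (v, u) \<notin> R"
begin

definition verts :: "'v gadget_vertex set" where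
  "verts = Terminal ` V \<union> (\<lambda>(e, x). Inner e x) ` (W \<times> (VG - {a}))"

text \<open>Edges between terminals and inner vertices are listed in one direction only;
  \<open>edges\<close> forgets directions. The condition \<open>x \<noteq> b\<close> is the deletion
  of \<open>{a, b}\<close>.\<close>

fun arc :: "'v gadget_vertex \<Rightarrow> 'v gadget_vertex \<Rightarrow> bool" where
  "arc (Terminal u) (Terminal v) \<longleftrightarrow> (u, v) \<in> R"
| "arc (Terminal u) (Inner e x) \<longleftrightarrow>
     e \<in> W \<and> (u = fst e \<and> {a, x} \<in> EG \<and> x \<noteq> b \<or> u = snd e \<and> x = b)"
| "arc (Inner e x) (Inner e' y) \<longleftrightarrow> e = e' \<and> e \<in> W \<and> {x, y} \<in> EG \<and> x \<noteq> a \<and> y \<noteq> a"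
| "arc (Inner e x) (Terminal u) \<longleftrightarrow> False"

definition edges :: "'v gadget_vertex set set" where
  "edges = {{x, y} | x y. arc x y}"

lemma edges_iff: "{x, y} \<in> edges \<longleftrightarrow> arc x y \<or> arc y x"
  unfolding edges_def by (auto simp: doubleton_eq_iff)

lemma finite_W: "finite W"
  using finite_V W_subset by (meson finite_SigmaI finite_subset)

lemma a_neq_b: "a \<noteq> b" and a_in: "a \<in> VG" and b_in: "b \<in> VG"
  using edgeG[OF abG] by auto

lemma arc_verts: "arc x y \<Longrightarrow> x \<in> verts \<and> y \<in> verts \<and> x \<noteq> y"
  using R_subset W_subset bipartite b_in a_neq_b
  by (cases "(x, y)" rule: arc.cases)
    (auto simp: verts_def image_iff dest: edgeG)

lemma simple_replacement: "simple_graph (verts, edges)"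
  unfolding simple_graph_def
proof (intro conjI ballI)
  show "finite (fst (verts, edges))"
    unfolding verts_def using finite_V finite_W finiteG by simp
  fix e assume "e \<in> snd (verts, edges)"
  then obtain x y where "e = {x, y}" "arc x y" unfolding edges_def by auto
  then show "\<exists>u v. u \<noteq> v \<and> u \<in> fst (verts, edges) \<and> v \<in> fst (verts, edges) \<and> e = {u, v}"
    using arc_verts by (metis fst_conv)
qed

lemma card_verts: "card verts \<le> card V + card W * card VG"
proof -
  have "card verts \<le> card (Terminal ` V) + card ((\<lambda>(e, x). Inner e x) ` (W \<times> (VG - {a})))"
    unfolding verts_def by (rule card_Un_le)
  also have "\<dots> \<le> card V + card (W \<times> (VG - {a}))"
    using finite_V finite_W finiteG by (intro add_mono card_image_le) auto
  also have "\<dots> \<le> card V + card W * card VG"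
    using finiteG by (simp add: card_cartesian_product card_Diff1_le)
  finally show ?thesis .
qed

text \<open>Reading the terminal \<open>p\<close> as \<open>a\<close> gives a colouring of the
  gadget minus \<open>{a, b}\<close>, so the copy of \<open>b\<close> repeats the colour of
  \<open>p\<close>, and its neighbour \<open>q\<close> must differ.\<close>

lemma coloring_restrict:
  assumes "colorable (verts, edges) c"
  obtains f where "f ` V \<subseteq> {..<c}" and "\<And>u v. (u, v) \<in> R \<union> W \<Longrightarrow> f u \<noteq> f v"
proof -
  obtain F where F: "F ` verts \<subseteq> {..<c}" "\<And>x y. {x, y} \<in> edges \<Longrightarrow> x \<noteq> y \<Longrightarrow> F x \<noteq> F y"
    using assms unfolding colorable_def by auto
  have F_arc: "F x \<noteq> F y" if "arc x y" for x y
    using F(2)[of x y] arc_verts[OF that] that edges_iff by blast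
  have "F (Terminal p) \<noteq> F (Terminal q)" if pq: "(p, q) \<in> W" for p q
  proof -
    define h where "h x = (if x = a then F (Terminal p) else F (Inner (p, q) x))" for x
    have arc_h: "arc (if x = a then Terminal p else Inner (p, q) x) (Inner (p, q) y)"
      if "{x, y} \<in> EG" "{x, y} \<noteq> {a, b}" "y \<noteq> a" for x y
      using that pq by (auto simp: doubleton_eq_iff)
    have "h a = h b"
    proof (rule equal_ends)
      show "h ` VG \<subseteq> {..<c}"
      proof
        fix t assume "t \<in> h ` VG"
        then obtain x where "x \<in> VG" "t = h x" by auto
        moreover have "p \<in> V" using pq W_subset by auto
        ultimately have "t \<in> F ` verts" using pq by (auto simp: h_def verts_def)
        then show "t \<in> {..<c}" using F(1) by auto
      qed
      fix x y assume xy: "{x, y} \<in> EG" "{x, y} \<noteq> {a, b}"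
      then have "x \<noteq> y" by (simp add: edgeG)
      then consider "y \<noteq> a" | "x \<noteq> a" by blast
      then show "h x \<noteq> h y"
      proof cases
        case 1
        then show ?thesis using F_arc[OF arc_h[OF xy]] by (auto simp: h_def)
      next
        case 2
        have "{y, x} \<in> EG" "{y, x} \<noteq> {a, b}" using xy by (auto simp: insert_commute)
        then show ?thesis using F_arc[OF arc_h[of y x]] 2 by (auto simp: h_def)
      qed
    qed
    moreover have "F (Terminal q) \<noteq> F (Inner (p, q) b)"
      using pq by (intro F_arc) simp
    ultimately show ?thesis using a_neq_b by (auto simp: h_def)
  qed
  moreover have "F (Terminal u) \<noteq> F (Terminal v)" if "(u, v) \<in> R" for u v
    using that by (intro F_arc) simp
  moreover have "(\<lambda>v. F (Terminal v)) ` V \<subseteq> {..<c}"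
    using F(1) unfolding verts_def by auto
  ultimately show ?thesis using that[of "\<lambda>v. F (Terminal v)"] by auto
qed

text \<open>Each gadget receives the same colouring \<open>h\<close>, with the colours
  \<open>h a\<close> and \<open>f p\<close> exchanged so that it fits the terminal \<open>p\<close>.
  The copy of \<open>b\<close> then has colour \<open>f p\<close>, which differs from
  \<open>f q\<close>.\<close>

lemma coloring_extend:
  assumes f: "f ` V \<subseteq> {..<c}"
    and fR: "\<And>u v. (u, v) \<in> R \<Longrightarrow> {Terminal u, Terminal v} \<noteq> d \<Longrightarrow> f u \<noteq> f v"
    and fW: "\<And>u v. (u, v) \<in> W \<Longrightarrow> f u \<noteq> f v"
  shows "colorable (verts, edges - {d}) c"
proof -
  obtain h where h: "h ` VG \<subseteq> {..<c}" "h a = h b"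
    "\<And>x y. {x, y} \<in> EG \<Longrightarrow> {x, y} \<noteq> {a, b} \<Longrightarrow> h x \<noteq> h y"
    using equal_ends_coloring by blast
  define swap where "swap p t = (if t = h a then f p else if t = f p then h a else t)" for p t
  have swap_eq: "swap p s = swap p t \<longleftrightarrow> s = t" for p s t
    unfolding swap_def by auto
  define F where "F z = (case z of Terminal v \<Rightarrow> f v | Inner e x \<Rightarrow> swap (fst e) (h x))" for z
  have F_ne: "F x \<noteq> F y" if "arc x y" "{x, y} \<noteq> d" for x y
    using that(1)
  proof (cases rule: arc.elims(2))
    case (1 u v)
    then show ?thesis using fR that(2) by (simp add: F_def)
  next
    case (2 u e z)
    show ?thesis
    proof (cases "u = fst e \<and> {a, z} \<in> EG \<and> z \<noteq> b")
      case True
      then have "h a \<noteq> h z" using h(3)[of a z] a_neq_b by (auto simp: doubleton_eq_iff)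
      then have "swap u (h a) \<noteq> swap u (h z)" by (simp add: swap_eq)
      then show ?thesis using 2 True by (simp add: F_def swap_def)
    next
      case False
      then have "e \<in> W" "u = snd e" "z = b" using 2 by auto
      then have "f (fst e) \<noteq> f u" using fW by (metis prod.collapse)
      then show ?thesis using 2 h(2) \<open>z = b\<close> by (simp add: F_def swap_def)
    qed
  next
    case (3 e z e' z')
    then have "h z \<noteq> h z'" using h(3)[of z z'] by (auto simp: doubleton_eq_iff)
    then show ?thesis using 3 by (simp add: F_def swap_eq)
  qed
  show ?thesis unfolding colorable_def
  proof (intro exI[of _ F] conjI allI impI)
    have "swap (fst e) (h x) < c" if "e \<in> W" "x \<in> VG" for e x
    proof -
      have "fst e \<in> V" using that W_subset by auto
      then show ?thesis using f h(1) that a_in unfolding swap_def by (auto simp: image_subset_iff)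
    qed
    then show "F ` fst (verts, edges - {d}) \<subseteq> {..<c}"
      using f unfolding verts_def F_def by (auto simp: image_subset_iff)
    fix x y assume "{x, y} \<in> snd (verts, edges - {d})"
    then have "arc x y \<or> arc y x" "{x, y} \<noteq> d" using edges_iff by auto
    then show "F x \<noteq> F y" using F_ne[of x y] F_ne[of y x] by (auto simp: insert_commute)
  qed
qed

section \<open>Short odd cycles after the replacement\<close>

definition adj :: "'v gadget_vertex \<Rightarrow> 'v gadget_vertex \<Rightarrow> bool" where
  "adj x y \<longleftrightarrow> arc x y \<or> arc y x"

definition star :: "nat \<times> nat \<times> nat \<Rightarrow> nat \<times> nat \<times> nat \<Rightarrow> bool" where
  "star x y \<longleftrightarrow> {x, y} \<in> EG"

lemma star_sym: "star x y \<longleftrightarrow> star y x"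
  unfolding star_def by (simp add: insert_commute)

lemma adj_sym: "adj x y \<longleftrightarrow> adj y x"
  unfolding adj_def by auto

lemma adj_TT: "adj (Terminal u) (Terminal v) \<Longrightarrow> side u \<noteq> side v"
  unfolding adj_def using bipartite by auto

lemma adj_TI: "adj (Terminal u) (Inner e x) \<longleftrightarrow>
    e \<in> W \<and> (u = fst e \<and> star a x \<and> x \<noteq> b \<or> u = snd e \<and> x = b)"
  unfolding adj_def star_def by auto

lemma adj_IT: "adj (Inner e x) (Terminal u) \<longleftrightarrow>
    e \<in> W \<and> (u = fst e \<and> star a x \<and> x \<noteq> b \<or> u = snd e \<and> x = b)"
  using adj_TI adj_sym by metis

lemma adj_II: "adj (Inner e x) (Inner e' y) \<longleftrightarrow> e = e' \<and> e \<in> W \<and> star x y \<and> x \<noteq> a \<and> y \<noteq> a"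
  unfolding adj_def star_def by (auto simp: insert_commute)

lemma star_irrefl: "\<not> star x x" and star_ab: "star a b"
  using edgeG(1)[of x x] abG unfolding star_def by auto

lemma star_triangle: "star x y \<Longrightarrow> star y z \<Longrightarrow> star z x \<Longrightarrow> False"
  unfolding star_def by (rule triangle_pentagon_freeD(1)[OF freeG])

lemma star_pentagon:
  "star x y \<Longrightarrow> star y z \<Longrightarrow> star z u \<Longrightarrow> star u v \<Longrightarrow> star v x \<Longrightarrow> False"
  unfolding star_def by (rule triangle_pentagon_freeD(2)[OF freeG])

lemma adj_TIT: "adj (Terminal u) (Inner e x) \<Longrightarrow> adj (Inner e x) (Terminal v) \<Longrightarrow> u = v"
  unfolding adj_TI adj_IT by auto

text \<open>If both ends are entered through \<open>a\<close>, then \<open>a\<close>,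
  \<open>x\<close>, \<open>y\<close> form a triangle; if both through \<open>b\<close>, there is a
  loop at \<open>b\<close>; in the mixed case the deleted edge \<open>{a, b}\<close> completes a
  triangle.\<close>

lemma adj_TIIT:
  assumes "adj (Terminal u) (Inner e x)" "adj (Inner e x) (Inner e' y)"
    "adj (Inner e' y) (Terminal v)"
  shows False
  using assms star_irrefl star_ab star_triangle star_sym unfolding adj_TI adj_IT adj_II by metis

text \<open>The two ends are distinct by bipartiteness, hence they are the two members of a pair in
  \<open>W\<close>, and such pairs are not adjacent.\<close>

lemma adj_TIIIT:
  assumes "adj (Terminal u) (Inner e x)" "adj (Inner e x) (Inner e1 y)"
    "adj (Inner e1 y) (Inner e2 z)" "adj (Inner e2 z) (Terminal v)" "adj (Terminal v) (Terminal u)"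
  shows False
proof -
  have *: "e \<in> W" "u = fst e \<or> u = snd e" "v = fst e \<or> v = snd e"
    using assms unfolding adj_TI adj_IT adj_II by auto
  have "u \<noteq> v" using adj_TT[OF assms(5)] by auto
  then have "(u, v) \<in> W \<or> (v, u) \<in> W" using * by auto
  then show False using assms(5) W_R_disjoint unfolding adj_def by auto
qed

text \<open>The walk enters and leaves its gadget through the same terminal: via \<open>a\<close> it
  closes to a pentagon of the gadget, via \<open>b\<close> to a triangle.\<close>

lemma adj_TIIIIT:
  assumes "adj (Terminal u) (Inner e x)" "adj (Inner e x) (Inner e1 y)"
    "adj (Inner e1 y) (Inner e2 z)" "adj (Inner e2 z) (Inner e3 w)"
    "adj (Inner e3 w) (Terminal u)"
  shows False
proof -
  have *: "e \<in> W" "star x y" "star y z" "star z w"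
    "u = fst e \<and> star a x \<or> u = snd e \<and> x = b" "u = fst e \<and> star a w \<or> u = snd e \<and> w = b"
    using assms unfolding adj_TI adj_IT adj_II by auto
  have "fst e \<noteq> snd e" using W_irrefl[of "fst e" "snd e"] *(1) by simp
  then consider "star a x" "star a w" | "x = b" "w = b" using *(5,6) by metis
  then show False
  proof cases
    case 1
    then show False using *(2-4) star_pentagon[of a x y z w] star_sym by blast
  next
    case 2
    then show False using *(2-4) star_triangle[of b y z] by blast
  qed
qed

lemma no_triangle: "adj u v \<Longrightarrow> adj v w \<Longrightarrow> adj w u \<Longrightarrow> False"
  apply (cases u; cases v; cases w; hypsubst_thin)
  by (use adj_TT adj_TIT adj_TIIT adj_II star_triangle in metis)+

text \<open>The cases are the patterns of terminals and inner vertices. A single inner vertex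
  between terminals leads back to the same terminal and can be cut out; runs of two, three or four
  inner vertices are excluded above; terminals alone are bipartite, and inner vertices alone stay in
  one gadget.\<close>

lemma no_pentagon:
  "adj u v \<Longrightarrow> adj v w \<Longrightarrow> adj w x \<Longrightarrow> adj x y \<Longrightarrow> adj y u \<Longrightarrow> False"
  apply (cases u; cases v; cases w; cases x; cases y; hypsubst_thin)
  by (use adj_TT adj_TIT adj_TIIT adj_TIIIT adj_TIIIIT adj_II star_pentagon in metis)+

lemma triangle_pentagon_free_replacement: "triangle_pentagon_free edges"
  using no_triangle no_pentagon unfolding adj_def
  by (intro triangle_pentagon_freeI) (simp_all only: edges_iff, blast+)

lemma critical_graph:
  assumes c: "c \<ge> 1"
    and no_coloring: "\<And>f. f ` V \<subseteq> {..<c} \<Longrightarrow> (\<And>u v. (u, v) \<in> R \<union> W \<Longrightarrow> f u \<noteq> f v) \<Longrightarrow> False"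
    and R0: "R0 \<subseteq> R" "\<And>u v. (u, v) \<in> R0 \<Longrightarrow> side v"
    and critical: "\<And>e. e \<in> R0 \<Longrightarrow>
      \<exists>f. f ` V \<subseteq> {..<c} \<and> (\<forall>u v. (u, v) \<in> R \<union> W \<longrightarrow> (u, v) \<noteq> e \<longrightarrow> f u \<noteq> f v)"
  obtains G :: "nat graph" where "simple_graph G" and "k_critical G (Suc c)" and "odd_girth_gt G 5"
    and "card (fst G) \<le> card V + card W * card VG" and "card R0 \<le> card (snd G)"
proof -
  define edge where "edge e = {Terminal (fst e), Terminal (snd e)}" for e :: "'v \<times> 'v"
  have nc: "\<not> colorable (verts, edges) c"
    using coloring_restrict no_coloring by metis
  have sub: "edge ` R0 \<subseteq> edges"
  proof
    fix d assume "d \<in> edge ` R0"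
    then obtain e where e: "e \<in> R0" "d = edge e" by blast
    then have "(fst e, snd e) \<in> R" using R0(1) by auto
    then show "d \<in> edges" using e(2) edges_iff by (simp add: edge_def)
  qed
  have del: "colorable (verts, edges - {d}) c" if "d \<in> edge ` R0" for d
  proof -
    obtain e where e: "e \<in> R0" "d = edge e" using \<open>d \<in> edge ` R0\<close> by blast
    then obtain f where f: "f ` V \<subseteq> {..<c}"
      "\<And>u v. (u, v) \<in> R \<union> W \<Longrightarrow> (u, v) \<noteq> e \<Longrightarrow> f u \<noteq> f v"
      using critical by metis
    show ?thesis
    proof (rule coloring_extend[OF f(1)])
      show "f u \<noteq> f v" if "(u, v) \<in> R" "{Terminal u, Terminal v} \<noteq> d" for u v
        using f(2)[of u v] that e(2) by (cases e) (auto simp: edge_def)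
      show "f u \<noteq> f v" if "(u, v) \<in> W" for u v
      proof -
        have "(u, v) \<noteq> e" using W_R_disjoint[OF that] e(1) R0(1) by auto
        then show ?thesis using f(2)[of u v] that by simp
      qed
    qed
  qed
  obtain G :: "nat graph" where G: "simple_graph G" "k_critical G (Suc c)" "odd_girth_gt G 5"
    "card (fst G) = card verts" "card (edge ` R0) \<le> card (snd G)"
    by (rule critical_nat_graph[OF simple_replacement nc c triangle_pentagon_free_replacement sub del])
  \<comment> \<open>All pairs of \<open>R0\<close> point from the class \<open>False\<close> to the
    class \<open>True\<close>, so no edge is counted twice.\<close>
  have "inj_on edge R0"
  proof (rule inj_onI)
    fix d e assume de: "d \<in> R0" "e \<in> R0" "edge d = edge e"
    obtain u v where d: "d = (u, v)" by (cases d)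
    obtain x y where e: "e = (x, y)" by (cases e)
    have "side v" "side y" using de R0(2) d e by auto
    moreover have "side u \<noteq> side v" using bipartite de(1) R0(1) d by auto
    ultimately show "d = e" using de(3) d e by (auto simp: edge_def doubleton_eq_iff)
  qed
  then show ?thesis using that[of G] G card_verts by (simp add: card_image)
qed

end

section \<open>Simulating colour lists by palettes\<close>

datatype 'v list_vertex = Vertex 'v | Palette bool nat

instance list_vertex :: (countable) countable
  by countable_datatype

text \<open>The palette vertices of a colour \<open>i\<close> all receive the same colour, so joining \<open>u\<close> to palette vertices
  on the other side by real edges, at no cost in vertices, implements the list \<open>L u\<close>.\<close>

lemma critical_graph_from_list_coloring:
  fixes V :: "'v :: countable set" and L :: "'v \<Rightarrow> nat set"
  assumes gadget: "equality_gadget c (VG :: (nat \<times> nat \<times> nat) set) EG a b" and c: "c \<ge> 1"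
    and V: "finite V" "R \<subseteq> V \<times> V" "W \<subseteq> V \<times> V"
    and bipartite: "\<And>u v. (u, v) \<in> R \<Longrightarrow> side u \<noteq> side v"
    and W: "\<And>u v. (u, v) \<in> W \<Longrightarrow> u \<noteq> v" "\<And>u v. (u, v) \<in> W \<Longrightarrow> (u, v) \<notin> R \<and> (v, u) \<notin> R"
    and no_coloring: "\<And>f. (\<And>v. v \<in> V \<Longrightarrow> f v \<in> L v) \<Longrightarrow>
      (\<And>u v. (u, v) \<in> R \<union> W \<Longrightarrow> f u \<noteq> f v) \<Longrightarrow> False"
    and R0: "R0 \<subseteq> R" "\<And>u v. (u, v) \<in> R0 \<Longrightarrow> side v"
    and L: "\<And>v. v \<in> V \<Longrightarrow> L v \<subseteq> {..<c}"
    and critical: "\<And>e. e \<in> R0 \<Longrightarrow>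
      \<exists>f. (\<forall>v\<in>V. f v \<in> L v) \<and> (\<forall>u v. (u, v) \<in> R \<union> W \<longrightarrow> (u, v) \<noteq> e \<longrightarrow> f u \<noteq> f v)"
  obtains G :: "nat graph" where "simple_graph G" and "k_critical G (Suc c)" and "odd_girth_gt G 5"
    and "card (fst G) \<le> card V + 2 * c + (card W + (2 * c)\<^sup>2) * card VG"
    and "card R0 \<le> card (snd G)"
proof -
  define P where "P = (\<lambda>(s, i). Palette s i :: 'v list_vertex) ` (UNIV \<times> {..<c})"
  define V2 where "V2 = Vertex ` V \<union> P"
  define R2 where "R2 = map_prod Vertex Vertex ` R
    \<union> {(Vertex u, Palette (\<not> side u) i) | u i. u \<in> V \<and> i < c \<and> i \<notin> L u}"
  define WP :: "('v list_vertex \<times> 'v list_vertex) set"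
    where "WP = {(Palette s i, Palette t j) | s t i j. i < c \<and> j < c \<and> i \<noteq> j}"
  define W2 where "W2 = map_prod Vertex Vertex ` W \<union> WP"
  define side2 where "side2 x = (case x of Vertex v \<Rightarrow> side v | Palette s i \<Rightarrow> s)"
    for x :: "'v list_vertex"
  interpret equality_gadget c VG EG a b by (rule gadget)
  interpret gadget_replacement c VG EG a b V2 R2 W2 side2
  proof
    show "finite V2" unfolding V2_def P_def using V(1) by simp
    show "R2 \<subseteq> V2 \<times> V2" unfolding R2_def V2_def P_def using V(2) by auto
    show "W2 \<subseteq> V2 \<times> V2" unfolding W2_def WP_def V2_def P_def using V(3) by auto
    show "side2 u \<noteq> side2 v" if "(u, v) \<in> R2" for u v
      using that bipartite unfolding R2_def side2_def by auto
    show "u \<noteq> v" if "(u, v) \<in> W2" for u v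
      using that W(1) unfolding W2_def WP_def by auto
    show "(u, v) \<notin> R2 \<and> (v, u) \<notin> R2" if "(u, v) \<in> W2" for u v
      using that W(2) unfolding W2_def WP_def R2_def by (auto simp: map_prod_def)
  qed
  have card_P: "card P \<le> 2 * c" and fin_P: "finite P"
    using card_image_le[of "UNIV \<times> {..<c}" "\<lambda>(s, i). Palette s i :: 'v list_vertex"]
    unfolding P_def by (simp_all add: card_cartesian_product)
  have fin_W: "finite W" using V(1,3) by (meson finite_SigmaI finite_subset)
  have "card V2 \<le> card (Vertex ` V) + card P" unfolding V2_def by (rule card_Un_le)
  also have "\<dots> \<le> card V + 2 * c" using card_image_le[OF V(1), of Vertex] card_P by linarith
  finally have card_V2: "card V2 \<le> card V + 2 * c" .
  have "WP \<subseteq> P \<times> P" unfolding WP_def P_def by auto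
  then have "card WP \<le> card (P \<times> P)" using fin_P by (intro card_mono) auto
  also have "\<dots> \<le> (2 * c)\<^sup>2"
    using mult_le_mono[OF card_P card_P] by (simp add: card_cartesian_product power2_eq_square)
  finally have card_WP: "card WP \<le> (2 * c)\<^sup>2" .
  have "card W2 \<le> card (map_prod Vertex Vertex ` W) + card WP" unfolding W2_def by (rule card_Un_le)
  also have "\<dots> \<le> card W + (2 * c)\<^sup>2"
    using card_image_le[OF fin_W, of "map_prod Vertex Vertex"] card_WP by linarith
  finally have card_W2: "card W2 \<le> card W + (2 * c)\<^sup>2" .
  have no_coloring2: False
    if f: "f ` V2 \<subseteq> {..<c}" "\<And>u v. (u, v) \<in> R2 \<union> W2 \<Longrightarrow> f u \<noteq> f v" for f
  proof -
    have f_less: "f (Palette s i) < c" if "i < c" for s i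
      using f(1) that unfolding V2_def P_def by (auto simp: image_subset_iff)
    define p where "p i = f (Palette False i)" for i
    have p: "p ` {..<c} \<subseteq> {..<c}" using f_less unfolding p_def by auto
    have palette_neq: "f (Palette s i) \<noteq> f (Palette t j)" if "i < c" "j < c" "i \<noteq> j" for s t i j
      using f(2)[of "Palette s i" "Palette t j"] that unfolding W2_def WP_def by auto
    then have "inj_on p {..<c}" unfolding p_def inj_on_def by (metis lessThan_iff)
    then have bij: "bij_betw p {..<c} {..<c}"
      using p by (simp add: bij_betw_def endo_inj_surj)
    \<comment> \<open>All \<open>c\<close> colours occur among the \<open>p j\<close>, and the
      gadgets exclude those with \<open>j \<noteq> i\<close>.\<close>
    have palette: "f (Palette s i) = p i" if "i < c" for s i
    proof -
      have "f (Palette s i) \<in> {..<c}" using f_less that by simp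
      then obtain j where "j < c" "f (Palette s i) = p j"
        using bij unfolding bij_betw_def by auto
      then show ?thesis using palette_neq[OF that, of j s False] unfolding p_def by metis
    qed
    \<comment> \<open>Undoing the permutation \<open>p\<close> normalises the colouring so that
      palette index \<open>i\<close> stands for colour \<open>i\<close>.\<close>
    define g where "g v = the_inv_into {..<c} p (f (Vertex v))" for v
    have g: "g v < c \<and> p (g v) = f (Vertex v)" if "v \<in> V" for v
    proof -
      have "f (Vertex v) \<in> p ` {..<c}" using f(1) that bij unfolding V2_def bij_betw_def by auto
      then show ?thesis using bij unfolding g_def bij_betw_def
        by (metis f_the_inv_into_f lessThan_iff order_refl the_inv_into_into)
    qed
    show False
    proof (rule no_coloring[of g])
      fix v assume v: "v \<in> V"
      show "g v \<in> L v"
      proof (rule ccontr)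
        assume "g v \<notin> L v"
        then have "(Vertex v, Palette (\<not> side v) (g v)) \<in> R2"
          using v g[OF v] unfolding R2_def by blast
        then show False using f(2) g[OF v] palette by fastforce
      qed
    next
      fix u v assume uv: "(u, v) \<in> R \<union> W"
      then have "(Vertex u, Vertex v) \<in> R2 \<union> W2" unfolding R2_def W2_def
        by (auto intro: map_prod_imageI)
      moreover have "u \<in> V" "v \<in> V" using uv V by auto
      ultimately show "g u \<noteq> g v" using f(2) g by metis
    qed
  qed
  let ?R0 = "map_prod Vertex Vertex ` R0"
  have critical2: "\<exists>f. f ` V2 \<subseteq> {..<c} \<and>
      (\<forall>u v. (u, v) \<in> R2 \<union> W2 \<longrightarrow> (u, v) \<noteq> e \<longrightarrow> f u \<noteq> f v)" if "e \<in> ?R0" for e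
  proof -
    obtain d where d: "d \<in> R0" "e = map_prod Vertex Vertex d" using \<open>e \<in> ?R0\<close> by auto
    obtain f where f: "\<And>v. v \<in> V \<Longrightarrow> f v \<in> L v"
      "\<And>u v. (u, v) \<in> R \<union> W \<Longrightarrow> (u, v) \<noteq> d \<Longrightarrow> f u \<noteq> f v"
      using critical[OF d(1)] by metis
    define F where "F x = (case x of Vertex v \<Rightarrow> f v | Palette s i \<Rightarrow> i)" for x
    have "F u \<noteq> F v" if "(u, v) \<in> R2 \<union> W2" "(u, v) \<noteq> e" for u v
      using that f d unfolding R2_def W2_def WP_def F_def
      by (cases d) (auto simp: image_iff)
    moreover have "F ` V2 \<subseteq> {..<c}" using f(1) L unfolding V2_def P_def F_def by (auto simp: subset_iff)
    ultimately show ?thesis by (intro exI[of _ F]) simp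
  qed
  have "inj_on (map_prod Vertex Vertex) R0" by (auto simp: inj_on_def)
  then have card_R0: "card ?R0 = card R0" by (rule card_image)
  have sub: "?R0 \<subseteq> R2" using R0(1) unfolding R2_def by auto
  have side2: "side2 v" if "(u, v) \<in> ?R0" for u v
    using that R0(2) unfolding side2_def by auto
  obtain G :: "nat graph" where G: "simple_graph G" "k_critical G (Suc c)" "odd_girth_gt G 5"
    "card (fst G) \<le> card V2 + card W2 * card VG" "card ?R0 \<le> card (snd G)"
    by (rule critical_graph[OF c no_coloring2 sub side2 critical2])
  have "card V2 + card W2 * card VG \<le> card V + 2 * c + (card W + (2 * c)\<^sup>2) * card VG"
    by (intro add_mono mult_right_mono card_V2 card_W2) simp
  then show ?thesis using that[of G] G card_R0 by linarith
qed

section \<open>The dense construction\<close>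

datatype layer_vertex = Or bool bool nat | Aux bool bool nat | Mid bool nat nat | Fin bool nat nat

instance layer_vertex :: countable
  by countable_datatype

text \<open>For each side \<open>s\<close>, the vertices \<open>Or s r i\<close> (\<open>i < N\<close>) choose between the colours \<open>A s\<close> and
  \<open>choice s r\<close>; the path of the \<open>Aux s r i\<close> can be coloured iff not all of them choose \<open>A s\<close>.
  The vertex \<open>Mid s i j\<close> sees \<open>Or s False i\<close> and \<open>Or s True j\<close>, so some \<open>Mid s i j\<close> gets colour \<open>A s\<close>, and
  this may happen for a single pair only. The final layer of side \<open>s\<close> is the layer \<open>Mid s\<close> if
  \<open>A s = 0\<close>; otherwise it is a layer \<open>Fin s\<close> matched to \<open>Mid s\<close> with lists \<open>{0, A s}\<close>.
  Hence the final layers of both sides always contain the colour \<open>0\<close>, so that they cannot be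
  completely joined; deleting any one edge between them makes the graph colourable.\<close>

locale color_scheme =
  fixes c :: nat and A B D :: "bool \<Rightarrow> nat" and N :: nat
  assumes less_c: "A s < c" "B s < c" "D s < c"
    and distinct_colors: "A s \<noteq> B s" "A s \<noteq> D s" "B s \<noteq> D s"
    and separated: "(if A False = 0 then {B False, D False} else {A False}) \<inter>
      (if A True = 0 then {B True, D True} else {A True}) = {}"
    and odd_N: "odd N"
begin

definition choice :: "bool \<Rightarrow> bool \<Rightarrow> nat" where
  "choice s r = (if r then D s else B s)"

definition V :: "layer_vertex set" where
  "V = (\<lambda>(s, r, i). Or s r i) ` (UNIV \<times> UNIV \<times> {..<N})
    \<union> (\<lambda>(s, r, i). Aux s r i) ` (UNIV \<times> UNIV \<times> {..<N})
    \<union> (\<lambda>(s, i, j). Mid s i j) ` (UNIV \<times> {..<N} \<times> {..<N})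
    \<union> (\<lambda>(s, i, j). Fin s i j) ` ({s. A s \<noteq> 0} \<times> {..<N} \<times> {..<N})"

text \<open>The path of \<open>Aux\<close> vertices lacks \<open>B s\<close> at its start and
  \<open>D s\<close> at its end. Without \<open>A s\<close> its colours would alternate from
  \<open>D s\<close>, and for odd \<open>N\<close> they would end in the missing
  \<open>D s\<close>.\<close>

fun L :: "layer_vertex \<Rightarrow> nat set" where
  "L (Or s r i) = {A s, choice s r}"
| "L (Aux s r i) = {A s} \<union> (if i = 0 then {} else {B s}) \<union> (if Suc i = N then {} else {D s})"
| "L (Mid s i j) = {A s, B s, D s}"
| "L (Fin s i j) = {0, A s}"

definition final :: "bool \<Rightarrow> nat \<Rightarrow> nat \<Rightarrow> layer_vertex" where
  "final s i j = (if A s = 0 then Mid s i j else Fin s i j)"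

text \<open>Only these linearly many constraints cost gadgets; everything that touches the
  quadratically large layers is bipartite and goes into \<open>R\<close>.\<close>

definition W :: "(layer_vertex \<times> layer_vertex) set" where
  "W = (\<lambda>(s, r, i). (Or s r i, Aux s r i)) ` (UNIV \<times> UNIV \<times> {..<N})
    \<union> (\<lambda>(s, r, i). (Aux s r i, Aux s r (Suc i))) ` (UNIV \<times> UNIV \<times> {..<N - 1})"

definition R0 :: "(layer_vertex \<times> layer_vertex) set" where
  "R0 = (\<lambda>((i, j), k, l). (final False i j, final True k l)) `
     (({..<N} \<times> {..<N}) \<times> {..<N} \<times> {..<N})"

definition R :: "(layer_vertex \<times> layer_vertex) set" where
  "R = {(Or s r (if r then j else i), Mid s i j) | s r i j. i < N \<and> j < N}
    \<union> {(Mid s i j, Fin s i j) | s i j. A s \<noteq> 0 \<and> i < N \<and> j < N} \<union> R0"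

fun side :: "layer_vertex \<Rightarrow> bool" where
  "side (Or s r i) = (if A s = 0 then \<not> s else s)"
| "side (Aux s r i) = True"
| "side (Mid s i j) = (if A s = 0 then s else \<not> s)"
| "side (Fin s i j) = s"

lemma V_iff [simp]:
  "Or s r i \<in> V \<longleftrightarrow> i < N"
  "Aux s r i \<in> V \<longleftrightarrow> i < N"
  "Mid s i j \<in> V \<longleftrightarrow> i < N \<and> j < N"
  "Fin s i j \<in> V \<longleftrightarrow> A s \<noteq> 0 \<and> i < N \<and> j < N"
  unfolding V_def by (auto simp: image_iff Bex_def split_paired_Ex)

lemma WI:
  "i < N \<Longrightarrow> (Or s r i, Aux s r i) \<in> W"
  "Suc i < N \<Longrightarrow> (Aux s r i, Aux s r (Suc i)) \<in> W"
  unfolding W_def by (rule UnI1 UnI2, rule image_eqI[where x = "(s, r, i)"]; force)+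

lemma RI:
  "i < N \<Longrightarrow> j < N \<Longrightarrow> (Or s False i, Mid s i j) \<in> R"
  "i < N \<Longrightarrow> j < N \<Longrightarrow> (Or s True j, Mid s i j) \<in> R"
  "A s \<noteq> 0 \<Longrightarrow> i < N \<Longrightarrow> j < N \<Longrightarrow> (Mid s i j, Fin s i j) \<in> R"
  "i < N \<Longrightarrow> j < N \<Longrightarrow> k < N \<Longrightarrow> l < N \<Longrightarrow> (final False i j, final True k l) \<in> R"
  unfolding R_def R0_def
  by (force, force, force) (intro UnI2 image_eqI[where x = "((i, j), k, l)"]; simp)

lemma final_coloring_impossible:
  assumes f: "\<And>v. v \<in> V \<Longrightarrow> f v \<in> L v" and proper: "\<And>u v. (u, v) \<in> R \<union> W \<Longrightarrow> f u \<noteq> f v"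
  shows False
proof -
  have or: "\<exists>i<N. f (Or s r i) = choice s r" for s r
  proof (rule ccontr)
    assume contra: "\<not> ?thesis"
    have "f (Or s r i) = A s" if "i < N" for i
      using f[of "Or s r i"] contra that by auto
    moreover have "f (Or s r i) \<noteq> f (Aux s r i)" if "i < N" for i
      using proper WI(1)[OF that] by blast
    ultimately have neq: "f (Aux s r i) \<noteq> A s" if "i < N" for i
      using that by metis
    have list: "f (Aux s r i) \<in> L (Aux s r i)" if "i < N" for i
      by (rule f) (simp add: that)
    have alt: "f (Aux s r i) = (if even i then D s else B s)" if "i < N" for i
      using that
    proof (induction i)
      case 0
      then show ?case using neq[of 0] list[of 0] by (auto split: if_splits)
    next
      case (Suc i)
      have "f (Aux s r i) \<noteq> f (Aux s r (Suc i))"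
        using proper WI(2)[OF Suc.prems] by blast
      then show ?case using Suc neq[of "Suc i"] list[of "Suc i"] by (auto split: if_splits)
    qed
    obtain n where n: "Suc n = N" "even n" using odd_N by (cases N) auto
    have "f (Aux s r n) = D s" using alt[of n] n by simp
    then show False using list[of n] n distinct_colors[of s] by (simp split: if_splits)
  qed
  have mid: "\<exists>i<N. \<exists>j<N. f (Mid s i j) = A s" for s
  proof -
    obtain i where i: "i < N" "f (Or s False i) = B s" using or[of s False] by (auto simp: choice_def)
    obtain j where j: "j < N" "f (Or s True j) = D s" using or[of s True] by (auto simp: choice_def)
    \<comment> \<open>The two neighbours block \<open>B s\<close> and \<open>D s\<close>, which
      leaves \<open>A s\<close>.\<close>
    have "f (Mid s i j) \<noteq> B s" "f (Mid s i j) \<noteq> D s"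
      using proper[of "Or s False i" "Mid s i j"] proper[of "Or s True j" "Mid s i j"] RI(1,2) i j
      by auto
    then show ?thesis using f[of "Mid s i j"] i j by auto
  qed
  have fin: "\<exists>i<N. \<exists>j<N. f (final s i j) = 0" for s
  proof (cases "A s = 0")
    case True
    then show ?thesis using mid[of s] by (simp add: final_def)
  next
    case False
    obtain i j where ij: "i < N" "j < N" "f (Mid s i j) = A s" using mid by blast
    have "f (Fin s i j) \<noteq> A s"
      using proper[of "Mid s i j" "Fin s i j"] RI(3) ij False by auto
    then show ?thesis using f[of "Fin s i j"] ij False by (auto simp: final_def)
  qed
  obtain i j where ij: "i < N" "j < N" "f (final False i j) = 0" using fin by blast
  obtain k l where kl: "k < N" "l < N" "f (final True k l) = 0" using fin by blast
  show False using proper[of "final False i j" "final True k l"] RI(4) ij kl by simp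
qed

section \<open>Colourings with a single conflict\<close>

text \<open>The pair \<open>(I s, J s)\<close> marks the only vertex of \<open>Mid s\<close> with
  colour \<open>A s\<close>. Along the \<open>Aux\<close> path, \<open>A s\<close> is used once, at
  the marked index \<open>t\<close>; the alternation of \<open>D s\<close> and \<open>B s\<close>
  changes phase there, so the path starts and ends within its lists.\<close>

fun coloring :: "(bool \<Rightarrow> nat) \<Rightarrow> (bool \<Rightarrow> nat) \<Rightarrow> layer_vertex \<Rightarrow> nat" where
  "coloring I J (Or s r i) = (if i = (if r then J s else I s) then choice s r else A s)"
| "coloring I J (Aux s r i) = (let t = if r then J s else I s in
     if i = t then A s else if even i \<longleftrightarrow> i < t then D s else B s)"
| "coloring I J (Mid s i j) = (if i = I s then if j = J s then A s else D s else B s)"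
| "coloring I J (Fin s i j) = (if i = I s \<and> j = J s then 0 else A s)"

lemma coloring_in_list:
  assumes "\<And>s. I s < N" "\<And>s. J s < N" and "v \<in> V"
  shows "coloring I J v \<in> L v"
proof (cases v)
  case (Aux s r i)
  define t where "t = (if r then J s else I s)"
  have "t < N" using assms t_def by simp
  have "i < N" using assms(3) Aux unfolding V_def by auto
  show ?thesis using Aux \<open>t < N\<close> \<open>i < N\<close> odd_N by (auto simp: Let_def simp flip: t_def)
qed auto

lemma coloring_W: "(u, v) \<in> W \<Longrightarrow> coloring I J u \<noteq> coloring I J v"
  unfolding W_def
  by (auto simp: choice_def Let_def distinct_colors distinct_colors[symmetric] split: if_splits)

lemma coloring_final:
  "coloring I J (final s i j) =
    (if i = I s \<and> j = J s then 0 else if A s \<noteq> 0 then A s else if i = I s then D s else B s)"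
  unfolding final_def by auto

text \<open>In each final layer only the marked vertex has colour 0. The other colours of the two
  layers lie in the two sets of \<open>separated\<close>, so the sole conflict is between the marked
  vertices.\<close>

lemma coloring_R:
  assumes "(u, v) \<in> R" "(u, v) \<noteq> (final False (I False) (J False), final True (I True) (J True))"
  shows "coloring I J u \<noteq> coloring I J v"
proof -
  consider s r i j where "u = Or s r (if r then j else i)" "v = Mid s i j"
    | s i j where "A s \<noteq> 0" "u = Mid s i j" "v = Fin s i j"
    | i j k l where "u = final False i j" "v = final True k l"
    using assms(1) unfolding R_def R0_def by auto
  then show ?thesis
  proof cases
    case 1
    then show ?thesis using distinct_colors[of s] by (auto simp: choice_def)
  next
    case 2
    then show ?thesis using distinct_colors[of s] by auto
  next
    case 3
    then show ?thesis
      using assms(2) separated distinct_colors[of False] distinct_colors[of True]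
      unfolding 3 coloring_final by (auto split: if_splits)
  qed
qed

lemma finite_V: "finite V"
  unfolding V_def by simp

lemma R_subset: "R \<subseteq> V \<times> V"
  unfolding R_def R0_def final_def by (auto split: if_splits)

lemma W_subset: "W \<subseteq> V \<times> V"
  unfolding W_def by auto

lemma card_V: "card V \<le> 8 * N + (2 + card {s. A s \<noteq> 0}) * N\<^sup>2"
proof -
  have "card V \<le> card (UNIV \<times> UNIV \<times> {..<N} :: (bool \<times> bool \<times> nat) set)
    + card (UNIV \<times> UNIV \<times> {..<N} :: (bool \<times> bool \<times> nat) set)
    + card (UNIV \<times> {..<N} \<times> {..<N} :: (bool \<times> nat \<times> nat) set)
    + card ({s. A s \<noteq> 0} \<times> {..<N} \<times> {..<N})"
    unfolding V_def
    by (intro order_trans[OF card_Un_le] add_mono card_image_le) auto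
  then show ?thesis
    by (simp add: card_cartesian_product power2_eq_square algebra_simps)
qed

lemma card_W: "card W \<le> 8 * N"
proof -
  have "card W \<le> card (UNIV \<times> UNIV \<times> {..<N} :: (bool \<times> bool \<times> nat) set)
    + card (UNIV \<times> UNIV \<times> {..<N - 1} :: (bool \<times> bool \<times> nat) set)"
    unfolding W_def by (intro order_trans[OF card_Un_le] add_mono card_image_le) auto
  then show ?thesis by (simp add: card_cartesian_product)
qed

lemma card_R0: "card R0 = N ^ 4"
proof -
  have "inj_on (\<lambda>((i, j), k, l). (final False i j, final True k l))
      (({..<N} \<times> {..<N}) \<times> {..<N} \<times> {..<N})"
    by (auto simp: inj_on_def final_def split: if_splits)
  then show ?thesis
    unfolding R0_def by (simp add: card_image card_cartesian_product power4_eq_xxxx)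
qed

lemma critical_graph:
  assumes gadget: "equality_gadget c (VG :: (nat \<times> nat \<times> nat) set) EG a b"
  obtains G :: "nat graph" where "simple_graph G" and "k_critical G (Suc c)" and "odd_girth_gt G 5"
    and "card (fst G) \<le> (2 + card {s. A s \<noteq> 0}) * N\<^sup>2 + 8 * N + 2 * c
      + (8 * N + (2 * c)\<^sup>2) * card VG"
    and "N ^ 4 \<le> card (snd G)"
proof -
  have c: "c \<ge> 1" using less_c(1)[of True] by simp
  have bip: "side u \<noteq> side v" if "(u, v) \<in> R" for u v
    using that unfolding R_def R0_def final_def by (auto split: if_splits)
  have W: "u \<noteq> v" "(u, v) \<notin> R \<and> (v, u) \<notin> R" if "(u, v) \<in> W" for u v
    using that unfolding W_def R_def R0_def final_def by (auto split: if_splits)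
  have R0: "R0 \<subseteq> R" unfolding R_def by simp
  have R0_side: "side v" if "(u, v) \<in> R0" for u v
    using that unfolding R0_def final_def by (auto split: if_splits)
  have L: "L v \<subseteq> {..<c}" for v
    using less_c c by (cases v) (auto simp: choice_def)
  have critical: "\<exists>f. (\<forall>v\<in>V. f v \<in> L v) \<and>
      (\<forall>u v. (u, v) \<in> R \<union> W \<longrightarrow> (u, v) \<noteq> e \<longrightarrow> f u \<noteq> f v)" if "e \<in> R0" for e
  proof -
    obtain i j k l where e: "i < N" "j < N" "k < N" "l < N" "e = (final False i j, final True k l)"
      using \<open>e \<in> R0\<close> unfolding R0_def by auto
    \<comment> \<open>The marked vertices are the two ends of the edge to be deleted.\<close>
    let ?I = "\<lambda>s. if s then k else i" and ?J = "\<lambda>s. if s then l else j"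
    show ?thesis
      using coloring_in_list[of ?I ?J] coloring_R[of _ _ ?I ?J] coloring_W[of _ _ ?I ?J] e
      by (intro exI[of _ "coloring ?I ?J"]) auto
  qed
  obtain G :: "nat graph" where G: "simple_graph G" "k_critical G (Suc c)" "odd_girth_gt G 5"
    "card (fst G) \<le> card V + 2 * c + (card W + (2 * c)\<^sup>2) * card VG"
    "card R0 \<le> card (snd G)"
    by (rule critical_graph_from_list_coloring[OF gadget c finite_V R_subset W_subset bip W
        final_coloring_impossible R0 R0_side L critical])
  have "card V + 2 * c + (card W + (2 * c)\<^sup>2) * card VG
    \<le> (8 * N + (2 + card {s. A s \<noteq> 0}) * N\<^sup>2) + 2 * c + (8 * N + (2 * c)\<^sup>2) * card VG"
    by (intro add_mono mult_right_mono card_V card_W order_refl) simp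
  then show ?thesis using that[of G] G card_R0 by simp
qed

end

section \<open>Densities\<close>

lemma triangle_free_if_odd_girth:
  assumes "simple_graph (V, E)" and "odd_girth_gt (V, E) 5"
    and uvw: "{u, v} \<in> E" "{v, w} \<in> E" "{w, u} \<in> E"
  shows False
proof -
  have "is_cycle (V, E) [u, v, w]"
    unfolding is_cycle_def
  proof (intro conjI allI impI)
    show "distinct [u, v, w]" "set [u, v, w] \<subseteq> fst (V, E)"
      using uvw[THEN simple_graph_edge(1)[OF assms(1)]] uvw[THEN simple_graph_edge(2)[OF assms(1)]]
      by auto
    fix i assume "i < length [u, v, w]"
    then consider "i = 0" | "i = 1" | "i = 2" by fastforce
    then show "{[u, v, w] ! i, [u, v, w] ! ((i + 1) mod length [u, v, w])} \<in> snd (V, E)"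
      using uvw by cases simp_all
  qed simp
  then have "5 < length [u, v, w]"
    using assms(2) unfolding odd_girth_gt_def by (metis length_Cons list.size(3) odd_numeral numeral_3_eq_3)
  then show False by simp
qed

text \<open>Induction on the number of vertices, removing both ends of an edge
  \<open>{u, v}\<close>: every other vertex is adjacent to at most one of them.\<close>

lemma mantel:
  assumes "simple_graph (V, E)"
    and "\<And>u v w. {u, v} \<in> E \<Longrightarrow> {v, w} \<in> E \<Longrightarrow> {w, u} \<in> E \<Longrightarrow> False"
  shows "4 * card E \<le> (card V)\<^sup>2"
  using assms
proof (induction "card V" arbitrary: V E rule: less_induct)
  case less
  note simple = less.prems(1) and free = less.prems(2)
  have fin: "finite V" "finite E"
    using simple simple_graph_finite_edges unfolding simple_graph_def by auto
  show ?case
  proof (cases "E = {}")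
    case False
    then obtain u v where uv: "{u, v} \<in> E" using simple_graph_edgeE[OF simple] by blast
    then have uv': "u \<noteq> v" "u \<in> V" "v \<in> V" using simple_graph_edge[OF simple] by auto
    define V1 where "V1 = V - {u, v}"
    define E1 where "E1 = {e \<in> E. u \<notin> e \<and> v \<notin> e}"
    \<comment> \<open>\<open>g\<close> assigns to \<open>w\<close> its possible edge to
      \<open>u\<close> or \<open>v\<close>, so the edges lost, apart from \<open>{u, v}\<close>, lie
      in the image of \<open>g\<close>.\<close>
    define g where "g w = (if {u, w} \<in> E then {u, w} else {v, w})" for w
    have "V = insert u (insert v V1)" using uv' unfolding V1_def by auto
    moreover have "u \<notin> insert v V1" "v \<notin> V1" "finite V1"
      using uv' fin unfolding V1_def by auto
    ultimately have card_V: "card V = card V1 + 2" by simp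
    have "simple_graph (V1, E1)"
      unfolding simple_graph_def
    proof (intro conjI ballI)
      show "finite (fst (V1, E1))" using \<open>finite V1\<close> by simp
      fix e assume "e \<in> snd (V1, E1)"
      then have e: "e \<in> E" "u \<notin> e" "v \<notin> e" unfolding E1_def by auto
      then obtain x y where "x \<noteq> y" "x \<in> V" "y \<in> V" "e = {x, y}"
        using simple_graph_edgeE[OF simple] by blast
      then show "\<exists>x y. x \<noteq> y \<and> x \<in> fst (V1, E1) \<and> y \<in> fst (V1, E1) \<and> e = {x, y}"
        using e(2,3) unfolding V1_def by auto
    qed
    then have IH: "4 * card E1 \<le> (card V1)\<^sup>2"
    proof (rule less.hyps[rotated])
      show "card V1 < card V" using card_V by simp
      show False if "{x, y} \<in> E1" "{y, z} \<in> E1" "{z, x} \<in> E1" for x y z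
        using free[of x y z] that unfolding E1_def by simp
    qed
    have "E \<subseteq> E1 \<union> insert {u, v} (g ` V1)"
    proof
      fix e assume e: "e \<in> E"
      obtain x y where xy: "e = {x, y}" using simple_graph_edgeE[OF simple e] by blast
      have nbr: "\<not> ({u, w} \<in> E \<and> {v, w} \<in> E)" for w
        using free[of u v w] uv by (auto simp: insert_commute)
      have u: "{u, w} \<in> E1 \<union> insert {u, v} (g ` V1)" if "{u, w} \<in> E" for w
        using that simple_graph_edge[OF simple that] unfolding V1_def g_def by (cases "w = v") auto
      have v: "{v, w} \<in> E1 \<union> insert {u, v} (g ` V1)" if "{v, w} \<in> E" for w
      proof (cases "w = u")
        case False
        then have "w \<in> V1" "g w = {v, w}"
          using that simple_graph_edge[OF simple that] nbr unfolding V1_def g_def by auto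
        then show ?thesis by (metis UnI2 image_eqI insertI2)
      qed (simp add: insert_commute)
      show "e \<in> E1 \<union> insert {u, v} (g ` V1)"
      proof (cases "u \<in> e \<or> v \<in> e")
        case True
        then consider w where "e = {u, w}" | w where "e = {v, w}"
          using xy by (auto simp: insert_commute)
        then show ?thesis using u v e by cases auto
      qed (use e in \<open>simp add: E1_def\<close>)
    qed
    then have "card E \<le> card (E1 \<union> insert {u, v} (g ` V1))"
      using fin by (intro card_mono) (auto simp: E1_def V1_def)
    also have "\<dots> \<le> card E1 + card (insert {u, v} (g ` V1))" by (rule card_Un_le)
    finally have "card E \<le> card E1 + card (insert {u, v} (g ` V1))" .
    moreover have "card (insert {u, v} (g ` V1)) \<le> Suc (card (g ` V1))"
      using \<open>finite V1\<close> by (simp add: card_insert_if)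
    moreover have "card (g ` V1) \<le> card V1" using \<open>finite V1\<close> by (rule card_image_le)
    ultimately have "card E \<le> card E1 + Suc (card V1)" by linarith
    then have "4 * card E \<le> 4 * (card E1 + Suc (card V1))" by (rule mult_le_mono2)
    also have "\<dots> \<le> (card V1)\<^sup>2 + 4 * Suc (card V1)" using IH by simp
    also have "\<dots> = (card V)\<^sup>2" unfolding card_V by (simp add: power2_eq_square)
    finally show ?thesis .
  qed simp
qed

section \<open>Bounds on the supremum\<close>

definition dense_critical :: "nat \<Rightarrow> nat \<Rightarrow> real \<Rightarrow> nat graph \<Rightarrow> bool" where
  "dense_critical l k d G \<longleftrightarrow> simple_graph G \<and> k_critical G k \<and> odd_girth_gt G l \<and>
     real (card (snd G)) > d * (real (card (fst G)))\<^sup>2"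

lemma density_const_eq:
  "density_const l k = Sup {d. infinitely_many_graphs (dense_critical l k d)}"
  unfolding density_const_def dense_critical_def ..

lemma infinitely_many_graphs_ex:
  assumes "infinitely_many_graphs P"
  obtains G where "P G"
proof -
  have "\<exists>G. P G"
  proof (rule ccontr)
    assume "\<not> (\<exists>G. P G)"
    then have "\<forall>G. P G \<longrightarrow> (\<exists>H\<in>{}. graph_iso G H)" by blast
    then show False using assms unfolding infinitely_many_graphs_def by blast
  qed
  then show ?thesis using that by blast
qed

text \<open>A single such graph forces the bound, by Mantel's inequality. It also makes the set of
  densities bounded above, as lower bounds on its supremum require.\<close>

lemma density_less_quarter:
  assumes "infinitely_many_graphs (dense_critical 5 k d)"
  shows "d < 1 / 4"
proof -
  obtain V E where G: "dense_critical 5 k d (V, E)"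
    using infinitely_many_graphs_ex[OF assms] by (metis surj_pair)
  have "4 * card E \<le> (card V)\<^sup>2"
    using mantel triangle_free_if_odd_girth G unfolding dense_critical_def by metis
  then have "4 * real (card E) \<le> (real (card V))\<^sup>2"
    by (metis of_nat_le_iff of_nat_mult of_nat_numeral of_nat_power)
  moreover have "d * (real (card V))\<^sup>2 < real (card E)"
    using G unfolding dense_critical_def by simp
  ultimately have "d * (real (card V))\<^sup>2 < 1 / 4 * (real (card V))\<^sup>2" by linarith
  then show ?thesis by (rule mult_right_less_imp_less) simp
qed

lemma density_const_ge:
  assumes "\<And>d. d < D \<Longrightarrow> infinitely_many_graphs (dense_critical 5 k d)"
  shows "density_const 5 k \<ge> D"
  unfolding density_const_eq
proof (rule dense_le)
  fix d assume "d < D"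
  then have "d \<in> {d. infinitely_many_graphs (dense_critical 5 k d)}" using assms by simp
  moreover have "bdd_above {d. infinitely_many_graphs (dense_critical 5 k d)}"
    using density_less_quarter by (intro bdd_aboveI[of _ "1 / 4"]) (auto intro: less_imp_le)
  ultimately show "d \<le> Sup {d. infinitely_many_graphs (dense_critical 5 k d)}"
    by (rule cSup_upper)
qed

lemma density_const_le_quarter:
  assumes "infinitely_many_graphs (dense_critical 5 k d)"
  shows "density_const 5 k \<le> 1 / 4"
  unfolding density_const_eq
  using assms density_less_quarter by (intro cSup_least) (auto intro: less_imp_le)

text \<open>Isomorphic graphs have equally many vertices, so finitely many representatives bound the
  order.\<close>

lemma infinitely_many_graphsI:
  assumes "\<And>n. \<exists>G. P G \<and> n \<le> card (fst G)"
  shows "infinitely_many_graphs P"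
  unfolding infinitely_many_graphs_def
proof (rule notI, elim exE conjE)
  fix F :: "nat graph set"
  assume F: "finite F" "\<forall>G. P G \<longrightarrow> (\<exists>H\<in>F. graph_iso G H)"
  have "finite ((\<lambda>H. card (fst H)) ` F)" using F(1) by simp
  then obtain n where n: "\<And>H. H \<in> F \<Longrightarrow> card (fst H) < n"
    unfolding finite_nat_set_iff_bounded by blast
  obtain G where G: "P G" "n \<le> card (fst G)" using assms by blast
  then obtain H where H: "H \<in> F" "graph_iso G H" using F(2) by blast
  then have "card (fst G) = card (fst H)"
    unfolding graph_iso_def by (auto dest: bij_betw_same_card)
  then show False using G(2) n[OF H(1)] by simp
qed

text \<open>Up to terms linear in \<open>N\<close> there are \<open>m * N\<^sup>2\<close> vertices,
  one layer \<open>Mid\<close> per side and a layer \<open>Fin\<close> where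
  \<open>A s \<noteq> 0\<close>, against \<open>N ^ 4\<close> critical edges; the ratio tends to
  \<open>1 / m\<^sup>2\<close>.\<close>

lemma color_scheme_density:
  assumes scheme: "\<And>N. odd N \<Longrightarrow> color_scheme c A B D N"
    and d: "d < 1 / (real (2 + card {s. A s \<noteq> 0}))\<^sup>2"
  shows "infinitely_many_graphs (dense_critical 5 (Suc c) d)"
proof (rule infinitely_many_graphsI)
  fix n
  define m where "m = 2 + card {s. A s \<noteq> 0}"
  have "c \<ge> 1" using color_scheme.less_c(1)[OF scheme[of 1], of True] by simp
  then obtain VG EG a b where gadget: "equality_gadget c (VG :: (nat \<times> nat \<times> nat) set) EG a b"
    using equality_gadget_exists by blast
  define K where "K = 8 + 2 * c + (8 + (2 * c)\<^sup>2) * card VG"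
  \<comment> \<open>\<open>d\<close> may be negative, while the estimates below multiply by a
    nonnegative factor.\<close>
  define e where "e = max d 0"
  have "e < 1 / (real m)\<^sup>2" using d unfolding e_def m_def by simp
  then have "e * (real m + 0)\<^sup>2 < 1" unfolding m_def by (simp add: pos_less_divide_eq)
  moreover have "(\<lambda>N. e * (real m + real K / real N)\<^sup>2) \<longlonglongrightarrow> e * (real m + 0)\<^sup>2"
    by (intro tendsto_intros lim_const_over_n)
  ultimately have "\<forall>\<^sub>F N in sequentially. e * (real m + real K / real N)\<^sup>2 < 1"
    by (rule order_tendstoD(2)[rotated])
  then obtain N0 where N0: "\<And>N. N \<ge> N0 \<Longrightarrow> e * (real m + real K / real N)\<^sup>2 < 1"
    unfolding eventually_sequentially by blast
  define N where "N = 2 * max N0 n + 1"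
  have N: "odd N" "N \<ge> N0" "N \<ge> n" "N > 0" unfolding N_def by auto
  interpret color_scheme c A B D N by (rule scheme[OF N(1)])
  obtain G :: "nat graph" where G: "simple_graph G" "k_critical G (Suc c)" "odd_girth_gt G 5"
    "card (fst G) \<le> m * N\<^sup>2 + 8 * N + 2 * c + (8 * N + (2 * c)\<^sup>2) * card VG"
    "N ^ 4 \<le> card (snd G)"
    using critical_graph[OF gadget] unfolding m_def by metis
  have "2 * c \<le> 2 * c * N" "(2 * c)\<^sup>2 \<le> (2 * c)\<^sup>2 * N" using N(4) by simp_all
  then have "8 * N + 2 * c + (8 * N + (2 * c)\<^sup>2) * card VG
      \<le> 8 * N + 2 * c * N + (8 * N + (2 * c)\<^sup>2 * N) * card VG"
    by (intro add_mono mult_right_mono order_refl) simp_all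
  also have "\<dots> = K * N" unfolding K_def by (simp add: algebra_simps)
  finally have "card (fst G) \<le> m * N\<^sup>2 + K * N" using G(4) by linarith
  then have "real (card (fst G)) \<le> real m * (real N)\<^sup>2 + real K * real N"
    by (metis of_nat_add of_nat_le_iff of_nat_mult of_nat_power)
  also have "\<dots> = (real m + real K / real N) * (real N)\<^sup>2"
    using N(4) by (simp add: field_simps power2_eq_square)
  finally have "(real (card (fst G)))\<^sup>2 \<le> ((real m + real K / real N) * (real N)\<^sup>2)\<^sup>2"
    by (intro power_mono) simp_all
  then have "d * (real (card (fst G)))\<^sup>2 \<le> e * ((real m + real K / real N) * (real N)\<^sup>2)\<^sup>2"
    unfolding e_def by (intro mult_mono) auto
  also have "\<dots> = (e * (real m + real K / real N)\<^sup>2) * real N ^ 4"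
    by (simp add: power_mult_distrib)
  also have "\<dots> < 1 * real N ^ 4"
    using N0[OF N(2)] N(4) by (intro mult_strict_right_mono) simp_all
  also have "\<dots> \<le> real (card (snd G))" using G(5) by (simp flip: of_nat_power)
  finally have "dense_critical 5 (Suc c) d G" using G unfolding dense_critical_def by simp
  \<comment> \<open>Mantel's inequality turns the \<open>N ^ 4\<close> edges into at least
    \<open>N\<^sup>2\<close> vertices.\<close>
  moreover have "n \<le> card (fst G)"
  proof -
    obtain V E where VE: "G = (V, E)" by (cases G)
    have "(N\<^sup>2)\<^sup>2 \<le> 4 * card E" using G(5) unfolding VE by simp
    also have "\<dots> \<le> (card V)\<^sup>2"
      using mantel[of V E] triangle_free_if_odd_girth[of V E] G(1,3) unfolding VE by blast
    finally have "N\<^sup>2 \<le> card V" by (rule power2_le_imp_le) simp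
    moreover have "N \<le> N\<^sup>2" using N(4) by (simp add: power2_eq_square)
    ultimately show ?thesis using N(3) unfolding VE by simp
  qed
  ultimately show "\<exists>G. dense_critical 5 (Suc c) d G \<and> n \<le> card (fst G)" by blast
qed

lemma infinitely_many_dense_critical_ge_6:
  assumes "k \<ge> 6" and "d < 1 / 4"
  shows "infinitely_many_graphs (dense_critical 5 k d)"
proof -
  \<comment> \<open>Five colours suffice for \<open>A s = 0\<close> on both sides with disjoint
    pairs \<open>{1, 2}\<close> and \<open>{3, 4}\<close>.\<close>
  define A B D :: "bool \<Rightarrow> nat" where "A = (\<lambda>s. 0)" and "B = (\<lambda>s. if s then 1 else 3)"
    and "D = (\<lambda>s. if s then 2 else 4)"
  have "color_scheme (k - 1) A B D N" if "odd N" for N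
    using that assms(1) by unfold_locales (auto simp: A_def B_def D_def)
  then show ?thesis using color_scheme_density[of "k - 1" A B D d] assms by (simp add: A_def)
qed

theorem theorem2:
  shows "(\<exists>c::real > 0. \<exists>\<G> :: nat graph set.
            (\<forall>G\<in>\<G>. simple_graph G \<and> critical G \<and> odd_girth_gt G 5 \<and>
                     real (card (snd G)) > c * (real (card (fst G)))\<^sup>2) \<and>
            (\<forall>N. \<exists>G\<in>\<G>. chromatic_number G \<ge> N))
       \<and> density_const 5 4 \<ge> 1/36
       \<and> density_const 5 5 \<ge> 3/35
       \<and> (\<forall>k\<ge>6. density_const 5 k = 1/4)"
proof (intro conjI allI impI)
  let ?\<G> = "{G. \<exists>k. dense_critical 5 k (1/8) G}"
  show "\<exists>c::real > 0. \<exists>\<G> :: nat graph set.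
            (\<forall>G\<in>\<G>. simple_graph G \<and> critical G \<and> odd_girth_gt G 5 \<and>
                     real (card (snd G)) > c * (real (card (fst G)))\<^sup>2) \<and>
            (\<forall>N. \<exists>G\<in>\<G>. chromatic_number G \<ge> N)"
  proof (intro exI[of _ "1/8"] exI[of _ ?\<G>] conjI ballI allI)
    fix N :: nat
    have "infinitely_many_graphs (dense_critical 5 (max 6 N) (1/8))"
      by (rule infinitely_many_dense_critical_ge_6) simp_all
    then obtain G where "dense_critical 5 (max 6 N) (1/8) G" by (rule infinitely_many_graphs_ex)
    then show "\<exists>G\<in>?\<G>. chromatic_number G \<ge> N"
      by (intro bexI[of _ G]) (auto simp: dense_critical_def k_critical_def)
  qed (auto simp: dense_critical_def critical_def)
next
  \<comment> \<open>With three colours, \<open>separated\<close> rules out \<open>A s = 0\<close> on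
    either side, so both sides carry a layer \<open>Fin\<close>; the density \<open>1/16\<close>
    exceeds \<open>1/36\<close>.\<close>
  define A B D :: "bool \<Rightarrow> nat" where "A = (\<lambda>s. if s then 2 else 1)" and "B = (\<lambda>s. 0)"
    and "D = (\<lambda>s. if s then 1 else 2)"
  have "color_scheme 3 A B D N" if "odd N" for N
    using that by unfold_locales (auto simp: A_def B_def D_def)
  moreover have "{s. A s \<noteq> 0} = UNIV" by (auto simp: A_def)
  then have "card {s. A s \<noteq> 0} = 2" by simp
  ultimately have "infinitely_many_graphs (dense_critical 5 (Suc 3) d)" if "d < 1/36" for d
    using color_scheme_density[of 3 A B D d] that by simp
  then show "density_const 5 4 \<ge> 1/36" by (intro density_const_ge) simp
next
  \<comment> \<open>Side \<open>True\<close> uses the pair \<open>{2, 3}\<close> directly; side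
    \<open>False\<close> has only colour 1 left and carries a layer \<open>Fin\<close>. The density
    \<open>1/9\<close> exceeds \<open>3/35\<close>.\<close>
  define A B D :: "bool \<Rightarrow> nat" where "A = (\<lambda>s. if s then 0 else 1)" and "B = (\<lambda>s. 2)"
    and "D = (\<lambda>s. 3)"
  have "color_scheme 4 A B D N" if "odd N" for N
    using that by unfold_locales (auto simp: A_def B_def D_def)
  moreover have "{s. A s \<noteq> 0} = {False}" by (auto simp: A_def split: if_splits)
  then have "card {s. A s \<noteq> 0} = 1" by simp
  ultimately have "infinitely_many_graphs (dense_critical 5 (Suc 4) d)" if "d < 3/35" for d
    using color_scheme_density[of 4 A B D d] that by simp
  then show "density_const 5 5 \<ge> 3/35" by (intro density_const_ge) simp
next
  fix k :: nat assume k: "k \<ge> 6"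
  show "density_const 5 k = 1/4"
  proof (rule antisym)
    show "density_const 5 k \<le> 1/4"
      \<comment> \<open>The value 0 shows that the set of densities is nonempty.\<close>
      using infinitely_many_dense_critical_ge_6[OF k, of 0] by (intro density_const_le_quarter) simp
    show "1/4 \<le> density_const 5 k"
      using infinitely_many_dense_critical_ge_6[OF k] by (rule density_const_ge)
  qed
qed

end
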